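(* Let $a,b\in(0,\infty)$ with $ab<1$. If $f\in E(a,b)$, then $$\langle f,\varphi_n\rangle = O\!\left[n^{-1/4}\left(\frac{a+b-2ab}{a+b+2ab}\right)^{n/4}\right]\quad (n=1,2,\dots),$$ i.e. there is a constant $K=K(f)$ with $|\langle f,\varphi_n\rangle|\le K\, n^{-1/4}\left(\frac{a+b-2ab}{a+b+2ab}\right)^{n/4}$ for all $n\ge1$. Moreover this estimate is sharp: there exist $f\in E(a,b)$ and a constant $c>0$ such that $|\langle f,\varphi_n\rangle|\ge c\, n^{-1/4}\left(\frac{a+b-2ab}{a+b+2ab}\right)^{n/4}$ for all even $n\ge 2$.
   Context: For $f\in L^1(\mathbb{R})$ the Fourier transform is $\widehat f(\xi)=\frac{1}{\sqrt{2\pi}}\int_{\mathbb{R}} f(x)e^{-i\xi x}\,dx$. For $a>0$ let $g_a(x)=e^{-ax^2/2}$. For $a,b>0$, $E(a,b)$ is the set of $f\in L^1(\mathbb{R})$ for which there is a constant $C$ with $|f(x)|\le C g_a(x)$ for all $x\in\mathbb{R}$ and $|\widehat f(\xi)|\le C g_b(\xi)$ for all $\xi\in\mathbb{R}$. The normalized Hermite functions are $\varphi_n(x)=(2^n n!\sqrt{\pi})^{-1/2}H_n(x)e^{-x^2/2}$, where $H_n(x)=(-1)^n e^{x^2}\frac{d^n}{dx^n}e^{-x^2}$; they form an orthonormal basis of $L^2(\mathbb{R})$, and $\langle f,g\rangle=\int_{\mathbb{R}} f\overline{g}\,dx$. *)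

theory Defs
  imports "HOL-Analysis.Analysis"
begin

definition fourier :: "(real \<Rightarrow> complex) \<Rightarrow> real \<Rightarrow> complex" where
  "fourier f \<xi> = complex_of_real (1 / sqrt (2 * pi)) *
      (LINT x|lborel. f x * exp (- \<i> * complex_of_real (\<xi> * x)))"

definition gauss :: "real \<Rightarrow> real \<Rightarrow> real" where
  "gauss a x = exp (- a * x\<^sup>2 / 2)"

definition Eab :: "real \<Rightarrow> real \<Rightarrow> (real \<Rightarrow> complex) set" where
  "Eab a b = {f. integrable lborel f \<and>
     (\<exists>C. (\<forall>x. norm (f x) \<le> C * gauss a x) \<and> (\<forall>\<xi>. norm (fourier f \<xi>) \<le> C * gauss b \<xi>))}"

definition hermite :: "nat \<Rightarrow> real \<Rightarrow> real" where
  "hermite n x = (-1) ^ n * exp (x\<^sup>2) * ((deriv ^^ n) (\<lambda>t. exp (- t\<^sup>2)) x)"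

definition hermite_fun :: "nat \<Rightarrow> real \<Rightarrow> real" where
  "hermite_fun n x = (2 ^ n * fact n * sqrt pi) powr (-1/2) * hermite n x * exp (- x\<^sup>2 / 2)"

definition hermite_coeff :: "(real \<Rightarrow> complex) \<Rightarrow> nat \<Rightarrow> complex" where
  "hermite_coeff f n = (LINT x|lborel. f x * cnj (complex_of_real (hermite_fun n x)))"

end

theory Submission
  imports Defs "HOL-Complex_Analysis.Complex_Analysis" "HOL-Probability.Distributions"
begin

text \<open>
  The generating function of the Hermite polynomials turns the coefficients of \<open>f\<close> into the Taylor
  coefficients at \<open>0\<close> of an entire function \<open>F\<close>, the Bargmann transform of \<open>f\<close>. Writing
  \<open>w = u + i v\<close>, \<open>r = (1 - a) / (1 + a)\<close>, \<open>s = (1 - b) / (1 + b)\<close>, the decay of \<open>f\<close> gives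
  \<open>|F w| \<le> A exp (r u^2 + v^2)\<close>, and since the Fourier transform acts on \<open>F\<close> as the rotation
  \<open>w \<mapsto> i w\<close>, the decay of the transform gives \<open>|F w| \<le> A exp (u^2 + s v^2)\<close>.
  The minimum of the two exponents has a concave kink in each quadrant. In the sector between the
  two rays where the graph of \<open>L |w|^2 cos (2 \<theta> - 2 \<psi>)\<close>, \<open>\<theta> = arg w\<close>, touches the two exponents from below,
  Phragmen-Lindelof replaces the minimum by this function, and outside the sector the exponents
  are at most \<open>L' |w|^2\<close> with \<open>L' < L\<close>. Here \<open>L^2 = (a + b - 2 a b) / (a + b + 2 a b)\<close>. So on the circle
  \<open>|w| = \<rho>\<close> the function \<open>|F|\<close> is bounded by \<open>exp (L \<rho>^2)\<close> times four Gaussian peaks of width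
  \<open>1 / \<rho>\<close>, and Cauchy's formula with \<open>\<rho>^2 = n / (2 L)\<close> yields the estimate including the factor
  \<open>n^(-1/4)\<close>. It is attained by the complex Gaussian \<open>exp (- \<gamma> x^2 / 2)\<close> with
  \<open>Re \<gamma> = a\<close> and \<open>Re (1 / \<gamma>) = b\<close>.
\<close>

section \<open>Gaussian integrals with complex parameters\<close>

text \<open>For \<open>norm w < r\<close> the n-th term is at most
  \<open>norm (h x) * B x * q ^ n\<close> with \<open>q = norm w / r < 1\<close>. This sums to an
  integrable majorant, so sum and integral may be interchanged. It serves both holomorphy in a
  parameter and the Hermite expansion.\<close>

lemma integral_power_series:
  fixes h :: "'a \<Rightarrow> complex" and k :: "nat \<Rightarrow> 'a \<Rightarrow> complex"
  assumes [measurable]: "h \<in> borel_measurable M" "\<And>n. k n \<in> borel_measurable M"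
    and B: "\<And>n x. norm (k n x) * r ^ n \<le> B x"
    and int: "integrable M (\<lambda>x. norm (h x) * B x)"
    and sums: "\<And>x. (\<lambda>n. k n x * w ^ n) sums K x"
    and w: "norm w < r"
  shows "(\<lambda>n. (LINT x|M. h x * k n x) * w ^ n) sums (LINT x|M. h x * K x)"
proof -
  define q where "q = norm w / r"
  have r: "r > 0" using w by (meson norm_ge_zero le_less_trans)
  have q: "0 \<le> q" "q < 1" using r w by (auto simp: q_def)
  have bound: "norm (h x * k n x * w ^ n) \<le> norm (h x) * B x * q ^ n" for n x
  proof -
    have "norm (h x * k n x * w ^ n) = norm (h x) * (norm (k n x) * r ^ n) * q ^ n"
      using r by (simp add: q_def norm_mult norm_power power_divide)
    also have "\<dots> \<le> norm (h x) * B x * q ^ n"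
      using q by (intro mult_right_mono mult_left_mono B) auto
    finally show ?thesis .
  qed
  have int': "integrable M (\<lambda>x. h x * k n x * w ^ n)" for n
    by (rule Bochner_Integration.integrable_bound[OF integrable_mult_left[OF int, of "q ^ n"]])
       (use order_trans[OF bound abs_ge_self] in auto)
  have "summable (\<lambda>n. (LINT x|M. norm (h x) * B x) * q ^ n)"
    using q by (intro summable_mult summable_geometric) auto
  then have sm: "summable (\<lambda>n. LINT x|M. norm (h x * k n x * w ^ n))"
  proof (rule summable_comparison_test'[where N=0])
    fix n :: nat
    have "(LINT x|M. norm (h x * k n x * w ^ n)) \<le> (LINT x|M. norm (h x) * B x * q ^ n)"
      using int' int bound by (intro integral_mono) auto
    then show "norm (LINT x|M. norm (h x * k n x * w ^ n)) \<le> (LINT x|M. norm (h x) * B x) * q ^ n"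
      by (simp add: integral_nonneg_AE)
  qed
  have "summable (\<lambda>n. norm (h x * k n x * w ^ n))" for x
    by (rule summable_comparison_test'[where g="\<lambda>n. norm (h x) * B x * q ^ n"])
       (use q bound in \<open>auto intro!: summable_mult summable_geometric\<close>)
  then have "(\<lambda>n. LINT x|M. h x * k n x * w ^ n) sums (LINT x|M. (\<Sum>n. h x * k n x * w ^ n))"
    using sm int' by (intro sums_integral) auto
  moreover have "(\<Sum>n. h x * k n x * w ^ n) = h x * K x" for x
    using sums_mult[OF sums, of "h x" x] by (simp add: sums_iff mult.assoc)
  ultimately show ?thesis by simp
qed

text \<open>Expand the exponential in powers of \<open>c\<close>: a single term of the series of
  \<open>exp (r * |\<phi> x|)\<close> is at most the whole sum, which gives the majorant for
  termwise integration. The radius \<open>R\<close> may be finite because a quadratic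
  \<open>\<phi>\<close> against a Gaussian \<open>h\<close> is integrable for bounded
  \<open>r\<close> only.\<close>

lemma holomorphic_integral_exp:
  fixes h :: "'a \<Rightarrow> complex" and \<phi> :: "'a \<Rightarrow> real"
  assumes [measurable]: "h \<in> borel_measurable M" "\<phi> \<in> borel_measurable M"
    and int: "\<And>r. 0 < r \<Longrightarrow> r < R \<Longrightarrow> integrable M (\<lambda>x. norm (h x) * exp (r * \<bar>\<phi> x\<bar>))"
  shows "(\<lambda>c. LINT x|M. h x * exp (c * of_real (\<phi> x))) holomorphic_on ball 0 R"
proof (rule power_series_holomorphic)
  fix w :: complex assume "w \<in> ball 0 R"
  then obtain r where r: "norm w < r" "r < R" using dense by auto
  have r0: "r > 0" using r by (meson norm_ge_zero le_less_trans)
  have *: "norm (of_real (\<phi> x) ^ n / fact n :: complex) * r ^ n \<le> exp (r * \<bar>\<phi> x\<bar>)" for n x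
  proof -
    have "(r * \<bar>\<phi> x\<bar>) ^ n / fact n \<le> exp (r * \<bar>\<phi> x\<bar>)"
    proof -
      have "(\<Sum>i\<in>{n}. (r * \<bar>\<phi> x\<bar>) ^ i /\<^sub>R fact i) \<le> (\<Sum>i. (r * \<bar>\<phi> x\<bar>) ^ i /\<^sub>R fact i)"
        using r0 by (intro sum_le_suminf summable_exp_generic) auto
      then show ?thesis by (simp add: exp_def divide_inverse mult.commute)
    qed
    then show ?thesis by (simp add: norm_divide norm_power power_mult_distrib mult.commute)
  qed
  have "(\<lambda>n. (LINT x|M. h x * (of_real (\<phi> x) ^ n / fact n)) * w ^ n) sums (LINT x|M. h x * exp (w * of_real (\<phi> x)))"
  proof (rule integral_power_series[where B="\<lambda>x. exp (r * \<bar>\<phi> x\<bar>)" and r=r])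
    fix x
    show "(\<lambda>n. of_real (\<phi> x) ^ n / fact n * w ^ n) sums exp (w * of_real (\<phi> x))"
      using exp_converges[of "w * of_real (\<phi> x)"]
      by (simp add: scaleR_conv_of_real power_mult_distrib field_simps)
  qed (use * int[OF r0] r in auto)
  then show "(\<lambda>n. (LINT x|M. h x * (of_real (\<phi> x) ^ n / fact n)) * (w - 0) ^ n) sums (LINT x|M. h x * exp (w * of_real (\<phi> x)))"
    by simp
qed

text \<open>Completing the square turns the integrand into a multiple of the normal density with
  mean \<open>\<tau> / \<sigma>\<close> and standard deviation
  \<open>1 / sqrt \<sigma>\<close>.\<close>

lemma
  fixes \<sigma> \<tau> :: real
  assumes "\<sigma> > 0"
  shows integrable_gaussian_shift: "integrable lborel (\<lambda>x. exp (- \<sigma> * x\<^sup>2 / 2 + \<tau> * x))"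
    and integral_gaussian_shift:
      "(LINT x|lborel. exp (- \<sigma> * x\<^sup>2 / 2 + \<tau> * x)) = sqrt (2 * pi / \<sigma>) * exp (\<tau>\<^sup>2 / (2 * \<sigma>))"
proof -
  have eq: "exp (- \<sigma> * x\<^sup>2 / 2 + \<tau> * x) =
      (sqrt (2 * pi / \<sigma>) * exp (\<tau>\<^sup>2 / (2 * \<sigma>))) * normal_density (\<tau> / \<sigma>) (1 / sqrt \<sigma>) x" for x
  proof -
    have "- \<sigma> * x\<^sup>2 / 2 + \<tau> * x = \<tau>\<^sup>2 / (2 * \<sigma>) - (x - \<tau> / \<sigma>)\<^sup>2 / (2 * (1 / sqrt \<sigma>)\<^sup>2)"
      using assms by (simp add: field_simps power2_eq_square)
    then have "exp (- \<sigma> * x\<^sup>2 / 2 + \<tau> * x) =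
        exp (\<tau>\<^sup>2 / (2 * \<sigma>)) * exp (- (x - \<tau> / \<sigma>)\<^sup>2 / (2 * (1 / sqrt \<sigma>)\<^sup>2))"
      by (simp flip: exp_add)
    then show ?thesis using assms
      by (simp add: normal_density_def power_divide)
  qed
  show "integrable lborel (\<lambda>x. exp (- \<sigma> * x\<^sup>2 / 2 + \<tau> * x))"
    unfolding eq using assms by (intro integrable_mult_right) auto
  show "(LINT x|lborel. exp (- \<sigma> * x\<^sup>2 / 2 + \<tau> * x)) = sqrt (2 * pi / \<sigma>) * exp (\<tau>\<^sup>2 / (2 * \<sigma>))"
    unfolding eq using assms by simp
qed

lemma integrable_gaussian_abs:
  fixes \<sigma> \<tau> :: real
  assumes "\<sigma> > 0"
  shows "integrable lborel (\<lambda>x. exp (- \<sigma> * x\<^sup>2 / 2 + \<tau> * \<bar>x\<bar>))"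
proof (rule Bochner_Integration.integrable_bound)
  show "integrable lborel (\<lambda>x. exp (- \<sigma> * x\<^sup>2 / 2 + \<tau> * x) + exp (- \<sigma> * x\<^sup>2 / 2 + (- \<tau>) * x))"
    by (intro Bochner_Integration.integrable_add integrable_gaussian_shift assms)
  have "exp (- \<sigma> * x\<^sup>2 / 2 + \<tau> * \<bar>x\<bar>)
      \<le> exp (- \<sigma> * x\<^sup>2 / 2 + \<tau> * x) + exp (- \<sigma> * x\<^sup>2 / 2 + (- \<tau>) * x)" for x
    by (cases "x \<ge> 0") auto
  then show "AE x in lborel. norm (exp (- \<sigma> * x\<^sup>2 / 2 + \<tau> * \<bar>x\<bar>))
      \<le> norm (exp (- \<sigma> * x\<^sup>2 / 2 + \<tau> * x) + exp (- \<sigma> * x\<^sup>2 / 2 + (- \<tau>) * x))"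
    by (intro AE_I2) (simp only: real_norm_def abs_exp_cancel, rule order_trans[OF _ abs_ge_self], blast)
qed simp

lemma integrable_complex_gaussian:
  fixes \<mu> c :: complex
  assumes "Re \<mu> > 0"
  shows "integrable lborel (\<lambda>x. exp (- \<mu> * of_real (x\<^sup>2) / 2 + c * of_real x))"
proof (rule Bochner_Integration.integrable_bound[OF integrable_gaussian_shift[OF assms, of "Re c"]])
  show "AE x in lborel. norm (exp (- \<mu> * of_real (x\<^sup>2) / 2 + c * of_real x))
      \<le> norm (exp (- Re \<mu> * x\<^sup>2 / 2 + Re c * x))"
    by (simp add: norm_exp_eq_Re)
qed simp

lemma entireI:
  assumes "\<And>R. R > 0 \<Longrightarrow> f holomorphic_on ball (0::complex) R"
  shows "f holomorphic_on A"
proof -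
  have "f field_differentiable at z" for z
    using assms[of "norm z + 1"] holomorphic_on_imp_differentiable_at[of f "ball 0 (norm z + 1)" z]
    by (simp add: add.commute add_pos_nonneg)
  then show ?thesis by (simp add: holomorphic_on_def field_differentiable_at_within)
qed

lemma entire_gaussian_laplace:
  fixes h :: "real \<Rightarrow> complex"
  assumes [measurable]: "h \<in> borel_measurable lborel"
    and "\<sigma> > 0" and le: "\<And>x. norm (h x) \<le> C * exp (- \<sigma> * x\<^sup>2 / 2)"
  shows "(\<lambda>c. LINT x|lborel. h x * exp (c * of_real x)) holomorphic_on A"
proof (rule entireI, rule holomorphic_integral_exp)
  fix R r :: real
  show "integrable lborel (\<lambda>x. norm (h x) * exp (r * \<bar>x\<bar>))"
  proof (rule Bochner_Integration.integrable_bound)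
    show "integrable lborel (\<lambda>x. C * exp (- \<sigma> * x\<^sup>2 / 2 + r * \<bar>x\<bar>))"
      by (intro integrable_mult_right integrable_gaussian_abs assms)
    have "norm (h x) * exp (r * \<bar>x\<bar>) \<le> C * exp (- \<sigma> * x\<^sup>2 / 2) * exp (r * \<bar>x\<bar>)" for x
      by (intro mult_right_mono le) auto
    then have "norm (h x) * exp (r * \<bar>x\<bar>) \<le> C * exp (- \<sigma> * x\<^sup>2 / 2 + r * \<bar>x\<bar>)" for x
      by (simp only: exp_add mult.assoc)
    then show "AE x in lborel. norm (norm (h x) * exp (r * \<bar>x\<bar>))
        \<le> norm (C * exp (- \<sigma> * x\<^sup>2 / 2 + r * \<bar>x\<bar>))"
      by (intro AE_I2, subst (1) real_norm_def, subst abs_of_nonneg, simp)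
        (simp only: real_norm_def, rule order_trans[OF _ abs_ge_self], blast)
  qed simp
qed auto

text \<open>Supplies the accumulation point for the identity theorem.\<close>

lemma zero_islimpt_real_interval:
  assumes "R > 0"
  shows "(0::complex) islimpt of_real ` {-R<..<R}"
  unfolding islimpt_approachable
proof (intro allI impI)
  fix e :: real assume "e > 0"
  then show "\<exists>x'\<in>of_real ` {-R<..<R}. x' \<noteq> (0::complex) \<and> dist x' 0 < e"
    using assms by (intro bexI[of _ "of_real (min e R / 2)"] imageI) auto
qed

text \<open>
  Both complex Gaussian integrals below are continued analytically from real parameters. In \<open>\<mu>\<close>,
  the discs \<open>ball R R\<close> exhaust the right half-plane as \<open>R\<close> grows; in \<open>c\<close>, a real translation
  proves the formula on the line \<open>c = \<mu> y\<close>.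
\<close>

lemma complex_gaussian_integral_sq:
  assumes "Re \<mu> > 0"
  shows "(LINT x|lborel. exp (- \<mu> * of_real (x\<^sup>2) / 2))\<^sup>2 * \<mu> = of_real (2 * pi)"
proof -
  \<comment> \<open>Chosen so that \<open>(norm \<mu>)^2 < 2 * Re \<mu> * R\<close>, which says that
    the disc of radius \<open>R\<close> about \<open>R\<close> contains
    \<open>\<mu>\<close>.\<close>
  define R where "R = ((norm \<mu>)\<^sup>2 + 1) / (2 * Re \<mu>) + 1"
  have R: "R > 0" using assms by (auto simp: R_def intro!: add_nonneg_pos divide_nonneg_pos)
  have "(norm \<mu>)\<^sup>2 < 2 * Re \<mu> * R"
    using assms unfolding R_def distrib_left by simp
  then have "(norm (\<mu> - of_real R))\<^sup>2 < R\<^sup>2"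
    unfolding cmod_power2 by (simp add: power2_diff)
  then have mem: "\<mu> - of_real R \<in> ball 0 R" using R by (simp add: power2_less_imp_less)
  define N where "N = (\<lambda>c::complex. LINT x|lborel. exp (- of_real R * of_real (x\<^sup>2) / 2 :: complex) * exp (c * of_real (- x\<^sup>2 / 2)))"
  have hol: "N holomorphic_on ball 0 R"
    unfolding N_def
  proof (rule holomorphic_integral_exp)
    fix r :: real assume r: "0 < r" "r < R"
    have "integrable lborel (\<lambda>x. exp (- (R - r) * x\<^sup>2 / 2 + 0 * x))"
      using r by (intro integrable_gaussian_shift) auto
    moreover have "norm (exp (- of_real R * of_real (x\<^sup>2) / 2 :: complex)) * exp (r * \<bar>- x\<^sup>2 / 2\<bar>)
        = exp (- (R - r) * x\<^sup>2 / 2 + 0 * x)" for x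
      by (simp add: norm_exp_eq_Re flip: exp_add) (simp add: field_simps)
    ultimately show "integrable lborel (\<lambda>x. norm (exp (- of_real R * of_real (x\<^sup>2) / 2 :: complex)) * exp (r * \<bar>- x\<^sup>2 / 2\<bar>))"
      by simp
  qed auto
  have N: "N c = (LINT x|lborel. exp (- (of_real R + c) * of_real (x\<^sup>2) / 2))" for c
    unfolding N_def by (simp add: algebra_simps add_divide_distrib diff_divide_distrib flip: exp_add)
  \<comment> \<open>The squared identity involves no branch of the square root of
    \<open>\<mu>\<close>, so it is holomorphic on the whole disc; on the real interval it is the
    real Gaussian integral.\<close>
  have "(N (\<mu> - of_real R))\<^sup>2 * (of_real R + (\<mu> - of_real R)) - of_real (2 * pi) = 0"
  proof (rule analytic_continuation[where S="ball 0 R" and U="of_real ` {-R<..<R}" and \<xi>=0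
        and f="\<lambda>c. (N c)\<^sup>2 * (of_real R + c) - of_real (2 * pi)"])
    show "(\<lambda>c. (N c)\<^sup>2 * (of_real R + c) - of_real (2 * pi)) holomorphic_on ball 0 R"
      by (intro holomorphic_intros hol)
    show "(0::complex) islimpt of_real ` {-R<..<R}" by (rule zero_islimpt_real_interval[OF R])
    fix z :: complex assume "z \<in> of_real ` {-R<..<R}"
    then obtain y where y: "z = of_real y" "-R < y" "y < R" by auto
    have "N z = of_real (LINT x|lborel. exp (- (R + y) * x\<^sup>2 / 2 + 0 * x))"
      unfolding N y(1) by (subst integral_complex_of_real[symmetric]) (simp add: exp_of_real[symmetric])
    also have "\<dots> = of_real (sqrt (2 * pi / (R + y)))"
      using y by (subst integral_gaussian_shift) auto
    finally have "(N z)\<^sup>2 * (of_real R + z) = of_real ((sqrt (2 * pi / (R + y)))\<^sup>2 * (R + y))"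
      unfolding y(1) by (simp only: of_real_mult of_real_power of_real_add)
    also have "(sqrt (2 * pi / (R + y)))\<^sup>2 * (R + y) = 2 * pi"
      using y by simp
    finally show "(N z)\<^sup>2 * (of_real R + z) - of_real (2 * pi) = 0" by simp
  qed (use mem R in auto)
  then show ?thesis by (simp add: N)
qed

lemma complex_gaussian_integral_exp:
  assumes "Re \<mu> > 0"
  shows "(LINT x|lborel. exp (- \<mu> * of_real (x\<^sup>2) / 2 + c * of_real x)) =
      (LINT x|lborel. exp (- \<mu> * of_real (x\<^sup>2) / 2)) * exp (c\<^sup>2 / (2 * \<mu>))"
proof -
  define J where "J = (\<lambda>c. LINT x|lborel. exp (- \<mu> * of_real (x\<^sup>2) / 2) * exp (c * of_real x))"
  have hol: "J holomorphic_on UNIV"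
    unfolding J_def
    by (rule entire_gaussian_laplace[OF _ assms, where C=1]) (auto simp: norm_exp_eq_Re)
  have \<mu>: "\<mu> \<noteq> 0" using assms by auto
  have "J (\<mu> * (c / \<mu>)) - J 0 * exp (\<mu> * (c / \<mu>)\<^sup>2 / 2) = 0"
  proof (rule analytic_continuation[where S=UNIV and U="range of_real" and \<xi>=0
        and f="\<lambda>c. J (\<mu> * c) - J 0 * exp (\<mu> * c\<^sup>2 / 2)"])
    show "(\<lambda>c. J (\<mu> * c) - J 0 * exp (\<mu> * c\<^sup>2 / 2)) holomorphic_on UNIV"
      by (intro holomorphic_intros holomorphic_on_compose_gen[OF _ hol, unfolded o_def]) auto
    show "(0::complex) islimpt range of_real"
      by (rule islimpt_subset[OF zero_islimpt_real_interval[of 1]]) auto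
    fix z :: complex assume "z \<in> range of_real"
    then obtain y where z: "z = of_real y" by auto
    have eq: "exp (- \<mu> * of_real (x\<^sup>2) / 2) * exp (\<mu> * z * of_real x)
        = exp (\<mu> * z\<^sup>2 / 2) * exp (- \<mu> * of_real ((- y + 1 * x)\<^sup>2) / 2)" for x
      unfolding z by (simp add: power2_eq_square field_simps flip: exp_add)
    have "J (\<mu> * z) = exp (\<mu> * z\<^sup>2 / 2) * (LINT x|lborel. exp (- \<mu> * of_real ((- y + 1 * x)\<^sup>2) / 2))"
      unfolding J_def eq by simp
    also have "(LINT x|lborel. exp (- \<mu> * of_real ((- y + 1 * x)\<^sup>2) / 2)) = J 0"
      using lborel_integral_real_affine[of 1 "\<lambda>x. exp (- \<mu> * of_real (x\<^sup>2) / 2)" "-y"]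
      by (simp add: J_def)
    finally show "J (\<mu> * z) - J 0 * exp (\<mu> * z\<^sup>2 / 2) = 0" by simp
  qed auto
  moreover have "J c = (LINT x|lborel. exp (- \<mu> * of_real (x\<^sup>2) / 2 + c * of_real x))"
    unfolding J_def exp_add by simp
  moreover have "\<mu> * (c / \<mu>)\<^sup>2 / 2 = c\<^sup>2 / (2 * \<mu>)"
    using \<mu> by (simp add: power2_eq_square field_simps)
  ultimately show ?thesis using \<mu> by (simp add: J_def)
qed

section \<open>Hermite functions and the Bargmann transform\<close>

text \<open>Links the real derivatives that define \<open>hermite\<close> to complex ones, for which
  Cauchy's theory is available: along the real axis the imaginary part of \<open>G\<close> is
  constantly 0, and its real part is \<open>g\<close>.\<close>

lemma deriv_of_real:
  assumes hol: "G holomorphic_on UNIV" and G: "\<And>x. G (of_real x) = of_real (g x)"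
  shows "deriv G (of_real x) = of_real (deriv g x)"
proof -
  have "(G has_field_derivative deriv G (of_real x)) (at (of_real x))"
    using hol by (intro holomorphic_derivI[where S=UNIV]) auto
  then have *: "((\<lambda>x. G (of_real x)) has_vector_derivative deriv G (of_real x)) (at x)"
    by (rule has_vector_derivative_real_field)
  have "((\<lambda>x. Re (of_real (g x) :: complex)) has_vector_derivative Re (deriv G (of_real x))) (at x)"
    using bounded_linear.has_vector_derivative[OF bounded_linear_Re *] by (simp add: G)
  then have "deriv g x = Re (deriv G (of_real x))"
    by (intro DERIV_imp_deriv) (simp add: has_real_derivative_iff_has_vector_derivative)
  moreover have "((\<lambda>x. Im (of_real (g x) :: complex)) has_vector_derivative Im (deriv G (of_real x))) (at x)"
    using bounded_linear.has_vector_derivative[OF bounded_linear_Im *] by (simp add: G)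
  then have "((\<lambda>x. 0 :: real) has_vector_derivative Im (deriv G (of_real x))) (at x)" by simp
  then have "Im (deriv G (of_real x)) = 0"
    using vector_derivative_unique_at has_vector_derivative_const by blast
  ultimately show ?thesis by (simp add: complex_eq_iff)
qed

lemma higher_deriv_of_real:
  assumes hol: "G holomorphic_on UNIV" and G: "\<And>x. G (of_real x) = of_real (g x)"
  shows "(deriv ^^ n) G (of_real x) = of_real ((deriv ^^ n) g x)"
proof (induction n arbitrary: x)
  case (Suc n)
  have "(deriv ^^ n) G holomorphic_on UNIV"
    by (intro holomorphic_higher_deriv hol) auto
  from deriv_of_real[OF this Suc.IH] show ?case by simp
qed (simp add: G)

text \<open>Since \<open>2 x w - w^2 = x^2 - (x - w)^2\<close>, the generating function is
  \<open>exp (x^2)\<close> times a reflected translate of \<open>exp (- z^2)\<close>. The reflection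
  contributes the sign \<open>(- 1) ^ n\<close> of the Rodrigues formula.\<close>

lemma hermite_higher_deriv:
  "complex_of_real (hermite n x) = (deriv ^^ n) (\<lambda>w. exp (2 * of_real x * w - w\<^sup>2)) 0"
proof -
  define g where "g = (\<lambda>z::complex. exp (- z\<^sup>2))"
  have hol: "g holomorphic_on UNIV" unfolding g_def by (intro holomorphic_intros)
  have g: "g (of_real t) = of_real (exp (- t\<^sup>2))" for t
    by (simp add: g_def exp_of_real[symmetric])
  have eq: "(\<lambda>w. exp (2 * of_real x * w - w\<^sup>2)) = (\<lambda>w. exp (of_real x ^ 2) * g ((- 1) * w + of_real x))"
    by (rule ext) (simp add: g_def power2_eq_square algebra_simps flip: exp_add)
  have "(deriv ^^ n) (\<lambda>w. exp (2 * of_real x * w - w\<^sup>2)) 0 = exp (of_real x ^ 2) * (deriv ^^ n) (\<lambda>w. g ((- 1) * w + of_real x)) 0"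
    unfolding eq by (intro higher_deriv_cmult[where A=UNIV] holomorphic_on_compose_gen[OF _ hol, unfolded o_def] holomorphic_intros) auto
  also have "(deriv ^^ n) (\<lambda>w. g ((- 1) * w + of_real x)) 0 = (- 1) ^ n * (deriv ^^ n) g ((- 1) * 0 + of_real x)"
    by (rule higher_deriv_compose_linear'[OF hol, where S=UNIV]) auto
  also have "(deriv ^^ n) g ((- 1) * 0 + of_real x) = of_real ((deriv ^^ n) (\<lambda>t. exp (- t\<^sup>2)) x)"
    using higher_deriv_of_real[OF hol g] by simp
  finally show ?thesis by (simp add: hermite_def exp_of_real[symmetric])
qed

lemma hermite_generating:
  "(\<lambda>n. of_real (hermite n x) / fact n * w ^ n) sums exp (2 * of_real x * w - w\<^sup>2)"
  for w :: complex
  using holomorphic_power_series[of "\<lambda>w. exp (2 * of_real x * w - w\<^sup>2)" 0 "norm w + 1" w]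
  by (simp add: hermite_higher_deriv holomorphic_intros add.commute add_nonneg_pos)

text \<open>Cauchy's inequality for the generating function on the circle of radius
  \<open>r\<close>. The exponent is only linear in \<open>|x|\<close>, so Gaussian weights absorb
  it.\<close>

lemma hermite_bound:
  assumes "r > 0"
  shows "norm (of_real (hermite n x) / fact n :: complex) * r ^ n \<le> exp (2 * r * \<bar>x\<bar> + r\<^sup>2)"
proof -
  have "norm ((deriv ^^ n) (\<lambda>w::complex. exp (2 * of_real x * w - w\<^sup>2)) 0) \<le> fact n * exp (2 * r * \<bar>x\<bar> + r\<^sup>2) / r ^ n"
  proof (rule Cauchy_inequality)
    fix w :: complex assume "norm (0 - w) = r"
    then have w: "norm w = r" by simp
    have "Re (2 * of_real x * w - w\<^sup>2) \<le> norm (2 * of_real x * w - w\<^sup>2)"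
      by (rule complex_Re_le_cmod)
    also have "\<dots> \<le> norm (2 * of_real x * w) + norm (w\<^sup>2)" by (rule norm_triangle_ineq4)
    also have "\<dots> = 2 * r * \<bar>x\<bar> + r\<^sup>2" by (simp add: w norm_mult norm_power)
    finally show "norm (exp (2 * of_real x * w - w\<^sup>2)) \<le> exp (2 * r * \<bar>x\<bar> + r\<^sup>2)"
      by (simp only: norm_exp_eq_Re exp_le_cancel_iff)
  qed (use assms in \<open>auto intro!: holomorphic_intros continuous_intros\<close>)
  then have "\<bar>hermite n x\<bar> \<le> fact n * exp (2 * r * \<bar>x\<bar> + r\<^sup>2) / r ^ n"
    by (simp only: norm_of_real flip: hermite_higher_deriv)
  then show ?thesis using assms by (simp add: norm_divide field_simps)
qed

lemma borel_measurable_hermite[measurable]: "hermite n \<in> borel_measurable borel"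
proof (intro borel_measurable_continuous_onI)
  define g where "g = (\<lambda>z::complex. exp (- z\<^sup>2))"
  have hol: "g holomorphic_on UNIV" unfolding g_def by (intro holomorphic_intros)
  have g: "g (of_real t) = of_real (exp (- t\<^sup>2))" for t
    by (simp add: g_def exp_of_real[symmetric])
  have "(deriv ^^ n) g holomorphic_on UNIV" by (intro holomorphic_higher_deriv hol) auto
  then have "continuous_on UNIV ((deriv ^^ n) g)" by (rule holomorphic_on_imp_continuous_on)
  then have "continuous_on UNIV (\<lambda>x::real. (deriv ^^ n) g (of_real x))"
    by (rule continuous_on_compose2) (auto intro: continuous_on_of_real continuous_on_id)
  then have "continuous_on UNIV (\<lambda>x. (- 1) ^ n * exp (x\<^sup>2) * Re ((deriv ^^ n) g (of_real x)))"
    by (rule continuous_on_mult[OF _ continuous_on_Re, rotated]) (intro continuous_intros)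
  moreover have "hermite n = (\<lambda>x. (- 1) ^ n * exp (x\<^sup>2) * Re ((deriv ^^ n) g (of_real x)))"
    by (rule ext) (simp only: hermite_def higher_deriv_of_real[OF hol g] Re_complex_of_real)
  ultimately show "continuous_on UNIV (hermite n)" by (simp only:)
qed

text \<open>The usual Bargmann transform, up to a constant factor, at the point \<open>sqrt 2 * w\<close>.\<close>

definition bargmann :: "(real \<Rightarrow> complex) \<Rightarrow> complex \<Rightarrow> complex" where
  "bargmann f w = (LINT x|lborel. f x * of_real (exp (- x\<^sup>2 / 2)) * exp (2 * of_real x * w - w\<^sup>2))"

text \<open>Integrating the generating function termwise against
  \<open>f x * exp (- x^2 / 2)\<close> makes the Hermite integrals the Taylor coefficients of
  \<open>bargmann f\<close>. With \<open>a > - 1\<close> the total weight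
  \<open>exp (- (1 + a) x^2 / 2)\<close> still decays.\<close>

lemma
  assumes [measurable]: "f \<in> borel_measurable lborel" and a: "a > - 1"
    and le: "\<And>x. norm (f x) \<le> C * gauss a x"
  shows bargmann_entire: "bargmann f holomorphic_on UNIV"
    and hermite_coeff_bargmann:
      "hermite_coeff f n = of_real ((2 ^ n * fact n * sqrt pi) powr (- 1 / 2)) * (deriv ^^ n) (bargmann f) 0"
proof -
  define c where "c n = (LINT x|lborel. f x * of_real (exp (- x\<^sup>2 / 2)) * (of_real (hermite n x) / fact n))" for n
  have sums: "(\<lambda>n. c n * w ^ n) sums bargmann f w" for w
    unfolding c_def bargmann_def
  proof (rule integral_power_series[where r="norm w + 1"])
    define r where "r = norm w + 1"
    have r: "r > 0" by (simp add: r_def add_nonneg_pos)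
    show "norm (of_real (hermite n x) / fact n :: complex) * (norm w + 1) ^ n \<le> exp (2 * r * \<bar>x\<bar> + r\<^sup>2)" for n x
      using hermite_bound[OF r] by (simp add: r_def)
    show "integrable lborel (\<lambda>x. norm (f x * of_real (exp (- x\<^sup>2 / 2))) * exp (2 * r * \<bar>x\<bar> + r\<^sup>2))"
    proof (rule Bochner_Integration.integrable_bound)
      show "integrable lborel (\<lambda>x. C * exp (r\<^sup>2) * exp (- (1 + a) * x\<^sup>2 / 2 + (2 * r) * \<bar>x\<bar>))"
        using a by (intro integrable_mult_right integrable_gaussian_abs) auto
      have "norm (norm (f x * of_real (exp (- x\<^sup>2 / 2))) * exp (2 * r * \<bar>x\<bar> + r\<^sup>2))
          \<le> norm (C * exp (r\<^sup>2) * exp (- (1 + a) * x\<^sup>2 / 2 + (2 * r) * \<bar>x\<bar>))" for x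
      proof -
        have "norm (norm (f x * of_real (exp (- x\<^sup>2 / 2))) * exp (2 * r * \<bar>x\<bar> + r\<^sup>2))
            = norm (f x) * (exp (- x\<^sup>2 / 2) * exp (2 * r * \<bar>x\<bar> + r\<^sup>2))"
          by (simp add: norm_mult abs_mult)
        also have "\<dots> \<le> C * gauss a x * (exp (- x\<^sup>2 / 2) * exp (2 * r * \<bar>x\<bar> + r\<^sup>2))"
          by (intro mult_right_mono le) auto
        also have "\<dots> = C * (exp (- a * x\<^sup>2 / 2) * exp (- x\<^sup>2 / 2) * exp (2 * r * \<bar>x\<bar> + r\<^sup>2))"
          by (simp add: gauss_def)
        also have "exp (- a * x\<^sup>2 / 2) * exp (- x\<^sup>2 / 2) * exp (2 * r * \<bar>x\<bar> + r\<^sup>2)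
            = exp (r\<^sup>2) * exp (- (1 + a) * x\<^sup>2 / 2 + (2 * r) * \<bar>x\<bar>)"
          unfolding exp_add[symmetric] by (rule arg_cong[of _ _ exp]) (simp add: field_simps)
        also have "C * (exp (r\<^sup>2) * exp (- (1 + a) * x\<^sup>2 / 2 + (2 * r) * \<bar>x\<bar>))
            \<le> norm (C * exp (r\<^sup>2) * exp (- (1 + a) * x\<^sup>2 / 2 + (2 * r) * \<bar>x\<bar>))"
          by (simp only: real_norm_def mult.assoc abs_ge_self)
        finally show ?thesis .
      qed
      then show "AE x in lborel. norm (norm (f x * of_real (exp (- x\<^sup>2 / 2))) * exp (2 * r * \<bar>x\<bar> + r\<^sup>2))
          \<le> norm (C * exp (r\<^sup>2) * exp (- (1 + a) * x\<^sup>2 / 2 + (2 * r) * \<bar>x\<bar>))" by (intro AE_I2)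
    qed auto
    show "(\<lambda>n. of_real (hermite n x) / fact n * w ^ n) sums exp (2 * of_real x * w - w\<^sup>2)" for x
      by (rule hermite_generating)
  qed auto
  show "bargmann f holomorphic_on UNIV"
    by (rule entireI, rule power_series_holomorphic[where a=c]) (simp add: sums)
  have "bargmann f has_fps_expansion Abs_fps c"
    by (intro has_fps_expansionI) (simp add: sums)
  from fps_nth_fps_expansion[OF this, of n] have "(deriv ^^ n) (bargmann f) 0 = fact n * c n"
    by simp
  also have "\<dots> = (LINT x|lborel. f x * of_real (exp (- x\<^sup>2 / 2)) * of_real (hermite n x))"
    unfolding c_def by (subst integral_mult_right_zero[symmetric]) (simp add: field_simps)
  finally have deriv: "(deriv ^^ n) (bargmann f) 0 = (LINT x|lborel. f x * of_real (exp (- x\<^sup>2 / 2)) * of_real (hermite n x))" .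
  show "hermite_coeff f n = of_real ((2 ^ n * fact n * sqrt pi) powr (- 1 / 2)) * (deriv ^^ n) (bargmann f) 0"
    unfolding hermite_coeff_def hermite_fun_def deriv
    by (subst integral_mult_right_zero[symmetric]) (simp add: mult_ac)
qed

section \<open>Growth of the Bargmann transform and its rotation under the Fourier transform\<close>

lemma norm_integral_gaussian_le:
  fixes g :: "real \<Rightarrow> complex"
  assumes \<sigma>: "\<sigma> > 0" and le: "\<And>x. norm (g x) \<le> C * exp (- \<sigma> * x\<^sup>2 / 2 + \<tau> * x)"
  shows "norm (LINT x|lborel. g x) \<le> C * sqrt (2 * pi / \<sigma>) * exp (\<tau>\<^sup>2 / (2 * \<sigma>))"
proof -
  have "norm (LINT x|lborel. g x) \<le> (LINT x|lborel. norm (g x))" by (rule integral_norm_bound)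
  also have "\<dots> \<le> (LINT x|lborel. C * exp (- \<sigma> * x\<^sup>2 / 2 + \<tau> * x))"
    using order_trans[OF norm_ge_zero le]
    by (intro integral_mono' integrable_mult_right integrable_gaussian_shift \<sigma> le) auto
  also have "\<dots> = C * sqrt (2 * pi / \<sigma>) * exp (\<tau>\<^sup>2 / (2 * \<sigma>))"
    by (simp only: integral_mult_right_zero integral_gaussian_shift[OF \<sigma>] mult.assoc)
  finally show ?thesis .
qed

text \<open>With \<open>w = u + i v\<close> the integrand is at most
  \<open>C exp (v^2 - u^2) exp (- (1 + a) x^2 / 2 + 2 u x)\<close>, and the Gaussian integral adds
  \<open>2 u^2 / (1 + a)\<close> to the exponent.\<close>

lemma norm_bargmann_le:
  assumes a: "a > - 1" and le: "\<And>x. norm (f x) \<le> C * gauss a x"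
  shows "norm (bargmann f w) \<le> C * sqrt (2 * pi / (1 + a)) * exp ((1 - a) / (1 + a) * (Re w)\<^sup>2 + (Im w)\<^sup>2)"
proof -
  have "norm (bargmann f w) \<le> C * exp ((Im w)\<^sup>2 - (Re w)\<^sup>2) * sqrt (2 * pi / (1 + a)) * exp ((2 * Re w)\<^sup>2 / (2 * (1 + a)))"
    unfolding bargmann_def
  proof (rule norm_integral_gaussian_le)
    fix x
    have "norm (f x * of_real (exp (- x\<^sup>2 / 2)) * exp (2 * of_real x * w - w\<^sup>2))
        = norm (f x) * (exp (- x\<^sup>2 / 2) * exp (2 * x * Re w - ((Re w)\<^sup>2 - (Im w)\<^sup>2)))"
      by (simp add: norm_mult norm_exp_eq_Re power2_eq_square)
    also have "\<dots> \<le> C * gauss a x * (exp (- x\<^sup>2 / 2) * exp (2 * x * Re w - ((Re w)\<^sup>2 - (Im w)\<^sup>2)))"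
      by (intro mult_right_mono le) auto
    also have "\<dots> = C * (exp (- a * x\<^sup>2 / 2) * exp (- x\<^sup>2 / 2) * exp (2 * x * Re w - ((Re w)\<^sup>2 - (Im w)\<^sup>2)))"
      by (simp add: gauss_def)
    also have "exp (- a * x\<^sup>2 / 2) * exp (- x\<^sup>2 / 2) * exp (2 * x * Re w - ((Re w)\<^sup>2 - (Im w)\<^sup>2))
        = exp ((Im w)\<^sup>2 - (Re w)\<^sup>2) * exp (- (1 + a) * x\<^sup>2 / 2 + (2 * Re w) * x)"
      unfolding exp_add[symmetric] by (rule arg_cong[of _ _ exp]) (simp add: field_simps)
    finally show "norm (f x * of_real (exp (- x\<^sup>2 / 2)) * exp (2 * of_real x * w - w\<^sup>2))
        \<le> C * exp ((Im w)\<^sup>2 - (Re w)\<^sup>2) * exp (- (1 + a) * x\<^sup>2 / 2 + (2 * Re w) * x)"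
      by (simp only: mult.assoc)
  qed (use a in auto)
  also have "\<dots> = C * sqrt (2 * pi / (1 + a)) * (exp ((Im w)\<^sup>2 - (Re w)\<^sup>2) * exp ((2 * Re w)\<^sup>2 / (2 * (1 + a))))"
    by (simp only: mult_ac)
  also have "exp ((Im w)\<^sup>2 - (Re w)\<^sup>2) * exp ((2 * Re w)\<^sup>2 / (2 * (1 + a))) = exp ((1 - a) / (1 + a) * (Re w)\<^sup>2 + (Im w)\<^sup>2)"
    unfolding exp_add[symmetric] using a by (intro arg_cong[of _ _ exp]) (simp add: field_simps)
  finally show ?thesis .
qed

lemma standard_gaussian_exp:
  "(LINT x|lborel. exp (- of_real (x\<^sup>2) / 2 + c * of_real x)) = of_real (sqrt (2 * pi)) * exp (c\<^sup>2 / 2)"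
  for c :: complex
proof -
  have "(LINT x|lborel. exp (- (1::complex) * of_real (x\<^sup>2) / 2)) = of_real (LINT x|lborel. exp (- 1 * x\<^sup>2 / 2 + 0 * x))"
    by (subst integral_complex_of_real[symmetric]) (simp add: exp_of_real[symmetric])
  also have "\<dots> = of_real (sqrt (2 * pi))"
    by (subst integral_gaussian_shift) auto
  finally show ?thesis
    using complex_gaussian_integral_exp[of 1 c] by simp
qed

text \<open>The Bargmann kernel at \<open>w\<close> is, up to the factor \<open>sqrt (2 pi)\<close>,
  the integral of the kernel \<open>g\<close> at \<open>\<i> * w\<close> against
  \<open>exp (- \<i> \<xi> x)\<close>. Inserting this and exchanging the integrals makes the Fourier
  transform of \<open>f\<close> appear.\<close>

lemma bargmann_fourier:
  assumes f: "integrable lborel f"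
  shows "bargmann f w = bargmann (fourier f) (\<i> * w)"
proof -
  define g where "g \<xi> = exp (w\<^sup>2 - of_real (\<xi>\<^sup>2) / 2 + 2 * \<i> * w * of_real \<xi>)" for \<xi> :: real
  define k where "k = complex_of_real (1 / sqrt (2 * pi))"
  have [measurable]: "f \<in> borel_measurable lborel" using f by auto
  have [measurable]: "g \<in> borel_measurable lborel"
    unfolding g_def by measurable
  have intg: "integrable lborel g"
  proof -
    have eq: "g = (\<lambda>\<xi>. exp (w\<^sup>2) * exp (- 1 * of_real (\<xi>\<^sup>2) / 2 + 2 * \<i> * w * of_real \<xi>))"
      unfolding g_def exp_add[symmetric] by (intro ext arg_cong[of _ _ exp]) simp
    show ?thesis
      unfolding eq by (intro integrable_mult_right integrable_complex_gaussian) simp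
  qed
  define H where "H x \<xi> = f x * g \<xi> * exp (- \<i> * of_real (\<xi> * x))" for x \<xi>
  \<comment> \<open>The oscillating factor has modulus 1, so the double integrand is dominated by a
    product of integrable functions and Fubini applies.\<close>
  have nH: "norm (H x \<xi>) = norm (f x) * norm (g \<xi>)" for x \<xi>
    by (simp add: H_def norm_mult norm_exp_eq_Re)
  have "bargmann f w = (LINT x|lborel. k * (LINT \<xi>|lborel. H x \<xi>))"
    unfolding bargmann_def
  proof (rule Bochner_Integration.integral_cong[OF refl])
    fix x
    have "(LINT \<xi>|lborel. H x \<xi>) = f x * exp (w\<^sup>2) * (LINT \<xi>|lborel. exp (- of_real (\<xi>\<^sup>2) / 2 + (2 * \<i> * w - \<i> * of_real x) * of_real \<xi>))"
      unfolding H_def g_def by (subst integral_mult_right_zero[symmetric])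
        (simp add: algebra_simps flip: exp_add)
    also have "\<dots> = of_real (sqrt (2 * pi)) * (f x * (exp (w\<^sup>2) * exp ((2 * \<i> * w - \<i> * of_real x)\<^sup>2 / 2)))"
      unfolding standard_gaussian_exp by (simp only: mult_ac)
    also have "exp (w\<^sup>2) * exp ((2 * \<i> * w - \<i> * of_real x)\<^sup>2 / 2) = exp (of_real (- x\<^sup>2 / 2)) * exp (2 * of_real x * w - w\<^sup>2)"
      unfolding exp_add[symmetric]
      by (rule arg_cong[of _ _ exp]) (simp add: power2_eq_square field_simps)
    finally have "k * (LINT \<xi>|lborel. H x \<xi>) = (k * of_real (sqrt (2 * pi))) *
        (f x * (exp (of_real (- x\<^sup>2 / 2)) * exp (2 * of_real x * w - w\<^sup>2)))"
      by (simp only: mult.assoc)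
    also have "k * of_real (sqrt (2 * pi)) = 1"
      unfolding k_def of_real_mult[symmetric] by simp
    finally show "f x * of_real (exp (- x\<^sup>2 / 2)) * exp (2 * of_real x * w - w\<^sup>2) = k * (LINT \<xi>|lborel. H x \<xi>)"
      by (simp only: mult_1_left exp_of_real mult.assoc)
  qed
  also have "\<dots> = k * (LINT x|lborel. LINT \<xi>|lborel. H x \<xi>)"
    by simp
  also have "(LINT x|lborel. LINT \<xi>|lborel. H x \<xi>) = (LINT \<xi>|lborel. LINT x|lborel. H x \<xi>)"
  proof (rule lborel_pair.Fubini_integral[symmetric], rule lborel_pair.Fubini_integrable)
    show "(\<lambda>(x, \<xi>). H x \<xi>) \<in> borel_measurable (lborel \<Otimes>\<^sub>M lborel)"
      unfolding H_def by measurable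
    show "integrable lborel (\<lambda>x. LINT \<xi>|lborel. norm (case (x, \<xi>) of (x, \<xi>) \<Rightarrow> H x \<xi>))"
      using f by (simp add: nH)
    show "AE x in lborel. integrable lborel (\<lambda>\<xi>. case (x, \<xi>) of (x, \<xi>) \<Rightarrow> H x \<xi>)"
    proof (intro AE_I2)
      fix x
      have "integrable lborel (\<lambda>\<xi>. norm (f x) * norm (g \<xi>))"
        using intg by simp
      then show "integrable lborel (\<lambda>\<xi>. case (x, \<xi>) of (x, \<xi>) \<Rightarrow> H x \<xi>)"
      proof (rule Bochner_Integration.integrable_bound)
        show "(\<lambda>\<xi>. case (x, \<xi>) of (x, \<xi>) \<Rightarrow> H x \<xi>) \<in> borel_measurable lborel"
          unfolding H_def by simp
      qed (simp add: nH)
    qed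
  qed
  also have "k * (LINT \<xi>|lborel. LINT x|lborel. H x \<xi>) = (LINT \<xi>|lborel. g \<xi> * fourier f \<xi>)"
  proof -
    have "k * (LINT x|lborel. H x \<xi>) = g \<xi> * fourier f \<xi>" for \<xi>
    proof -
      have "(LINT x|lborel. H x \<xi>) = g \<xi> * (LINT x|lborel. f x * exp (- \<i> * of_real (\<xi> * x)))"
        unfolding H_def by (subst integral_mult_right_zero[symmetric]) (simp add: mult_ac)
      then show ?thesis by (simp add: fourier_def k_def)
    qed
    then show ?thesis by (subst integral_mult_right_zero[symmetric]) simp
  qed
  also have "\<dots> = bargmann (fourier f) (\<i> * w)"
    unfolding bargmann_def
  proof (rule Bochner_Integration.integral_cong[OF refl])
    fix \<xi>
    have "g \<xi> = of_real (exp (- \<xi>\<^sup>2 / 2)) * exp (2 * of_real \<xi> * (\<i> * w) - (\<i> * w)\<^sup>2)"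
      unfolding g_def exp_of_real[symmetric] exp_add[symmetric]
      by (rule arg_cong[of _ _ exp]) (simp add: power2_eq_square field_simps)
    then show "g \<xi> * fourier f \<xi> = fourier f \<xi> * of_real (exp (- \<xi>\<^sup>2 / 2)) * exp (2 * of_real \<xi> * (\<i> * w) - (\<i> * w)\<^sup>2)"
      by (simp only: mult_ac)
  qed
  finally show ?thesis .
qed

section \<open>Phragmen-Lindelof in a sector\<close>

text \<open>The substitution \<open>w = exp \<zeta>\<close> turns a sector into a strip, which avoids branches of powers of \<open>w\<close>.\<close>

lemma phragmen_lindelof_strip:
  fixes \<Phi> :: "complex \<Rightarrow> complex"
  assumes hol: "\<Phi> holomorphic_on UNIV"
    and A: "A \<ge> 0" and M: "M \<ge> 0"
    and growth: "\<And>z. \<alpha> \<le> Im z \<Longrightarrow> Im z \<le> \<beta> \<Longrightarrow> norm (\<Phi> z) \<le> A * exp (M * exp (2 * Re z))"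
    and edge: "\<And>z. Im z = \<alpha> \<or> Im z = \<beta> \<Longrightarrow> norm (\<Phi> z) \<le> A"
    and width: "\<alpha> < \<beta>" "\<beta> - \<alpha> < pi / 2"
    and \<zeta>: "\<alpha> \<le> Im \<zeta>" "Im \<zeta> \<le> \<beta>"
  shows "norm (\<Phi> \<zeta>) \<le> A"
proof (cases "Im \<zeta> = \<alpha> \<or> Im \<zeta> = \<beta>")
  case False
  define \<psi> where "\<psi> = (\<alpha> + \<beta>) / 2"
  have "2 < pi / (\<beta> - \<alpha>)" using width by (simp add: field_simps)
  then obtain p where p: "2 < p" "p < pi / (\<beta> - \<alpha>)" using dense by blast
  then have p': "p * (\<beta> - \<alpha>) < pi" using width by (simp add: field_simps)
  \<comment> \<open>\<open>exp (- \<epsilon> E)\<close> with \<open>2 < p\<close> beats the growth at \<open>+\<infinity>\<close>; at \<open>-\<infinity>\<close> the growth bound itself tends to \<open>A\<close>.\<close>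
  define c where "c = cos (p * (\<beta> - \<alpha>) / 2)"
  have c: "c > 0" unfolding c_def using p p' width
    by (intro cos_gt_zero_pi) (auto intro: less_le_trans[of _ 0])
  define E where "E z = exp (of_real p * (z - \<i> * of_real \<psi>))" for z
  \<comment> \<open>The real part of \<open>E z\<close> is
    \<open>exp (p * Re z) * cos (p * (Im z - \<psi>))\<close>. As \<open>\<psi>\<close> is the
    middle of the strip and \<open>p (\<beta> - \<alpha>) < pi\<close>, the cosine is at least
    \<open>c > 0\<close>.\<close>
  have ReE: "c * exp (p * Re z) \<le> Re (E z)" if "\<alpha> \<le> Im z" "Im z \<le> \<beta>" for z
  proof -
    have "\<bar>p * (Im z - \<psi>)\<bar> \<le> p * (\<beta> - \<alpha>) / 2"
      using that p by (auto simp: \<psi>_def abs_mult abs_if field_simps)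
    then have "c \<le> cos \<bar>p * (Im z - \<psi>)\<bar>"
      unfolding c_def using p p' width by (intro cos_monotone_0_pi_le) auto
    then have "c \<le> cos (p * (Im z - \<psi>))" by (simp only: cos_abs_real)
    then show ?thesis by (simp add: E_def Re_exp mult.commute)
  qed
  have eps: "norm (\<Phi> \<zeta>) * exp (- \<epsilon> * Re (E \<zeta>)) \<le> A" if \<epsilon>: "\<epsilon> > 0" for \<epsilon>
  proof -
    define G where "G z = \<Phi> z * exp (- of_real \<epsilon> * E z)" for z
    have nG: "norm (G z) = norm (\<Phi> z) * exp (- \<epsilon> * Re (E z))" for z
      by (simp add: G_def norm_mult norm_exp_eq_Re)
    have holG: "G holomorphic_on S" for S
      unfolding G_def E_def by (intro holomorphic_intros holomorphic_on_subset[OF hol]) auto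
    have "filterlim (\<lambda>L::real. exp ((p - 2) * L)) at_top at_top" using p by real_asymp
    \<comment> \<open>For such \<open>L\<close> the damping on the right edge
      \<open>Re z = L\<close> outweighs the growth \<open>M * exp (2 * L)\<close>.\<close>
    then have "eventually (\<lambda>L. M / (\<epsilon> * c) \<le> exp ((p - 2) * L)) at_top"
      by (simp add: filterlim_at_top)
    moreover have "eventually (\<lambda>L. \<bar>Re \<zeta>\<bar> < L) at_top" by (rule eventually_gt_at_top)
    ultimately have ev: "eventually (\<lambda>L. norm (G \<zeta>) \<le> A * exp (M * exp (- 2 * L))) at_top"
    proof eventually_elim
      case (elim L)
      show ?case
      proof (rule maximum_modulus_frontier[where f=G and S="box (Complex (- L) \<alpha>) (Complex L \<beta>)"])
        fix z assume "z \<in> frontier (box (Complex (- L) \<alpha>) (Complex L \<beta>))"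
        then have z: "- L \<le> Re z" "Re z \<le> L" "\<alpha> \<le> Im z" "Im z \<le> \<beta>"
            and fr: "Re z = - L \<or> Re z = L \<or> Im z = \<alpha> \<or> Im z = \<beta>"
          using elim width by (auto simp: frontier_box box_ne_empty in_box_complex_iff in_cbox_complex_iff split: if_splits)
        have RE: "0 \<le> Re (E z)" using ReE[OF z(3,4)] c by (meson exp_ge_zero less_imp_le mult_nonneg_nonneg order_trans)
        have one: "1 \<le> exp (M * exp (- 2 * L))" using M by simp
        have le: "norm (G z) \<le> norm (\<Phi> z)"
          unfolding nG using RE \<epsilon> by (intro mult_left_le) auto
        from fr consider "Re z = - L" | "Re z = L" | "Im z = \<alpha> \<or> Im z = \<beta>" by blast
        then show "norm (G z) \<le> A * exp (M * exp (- 2 * L))"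
        proof cases
          case 1
          then show ?thesis using le growth[OF z(3,4)] by simp
        next
          case 2
          have "M * exp (2 * L) \<le> \<epsilon> * c * exp ((p - 2) * L) * exp (2 * L)"
            using elim \<epsilon> c by (simp add: field_simps)
          also have "\<dots> = \<epsilon> * (c * exp (p * L))"
            by (simp add: algebra_simps flip: exp_add)
          also have "\<dots> \<le> \<epsilon> * Re (E z)"
            using ReE[OF z(3,4)] 2 \<epsilon> by simp
          finally have *: "M * exp (2 * L) - \<epsilon> * Re (E z) \<le> 0" by simp
          have "norm (G z) \<le> A * exp (M * exp (2 * L)) * exp (- \<epsilon> * Re (E z))"
            unfolding nG using growth[OF z(3,4)] 2 by (intro mult_right_mono) auto
          also have "\<dots> = A * exp (M * exp (2 * L) - \<epsilon> * Re (E z))"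
            by (simp add: exp_diff exp_minus field_simps)
          also have "\<dots> \<le> A * 1" using * A by (intro mult_left_mono) auto
          also have "\<dots> \<le> A * exp (M * exp (- 2 * L))" using one A by (intro mult_left_mono)
          finally show ?thesis .
        next
          case 3
          have "norm (G z) \<le> A * 1" using le edge[OF 3] by simp
          also have "\<dots> \<le> A * exp (M * exp (- 2 * L))" using one A by (intro mult_left_mono)
          finally show ?thesis .
        qed
      next
        show "\<zeta> \<in> box (Complex (- L) \<alpha>) (Complex L \<beta>)"
          using elim \<zeta> False by (auto simp: in_box_complex_iff)
      qed (auto intro: holG holomorphic_on_imp_continuous_on)
    qed
    \<comment> \<open>The rectangle is exhausted first, with \<open>\<epsilon>\<close> fixed; only
      then does \<open>\<epsilon>\<close> tend to 0.\<close>
    have "((\<lambda>L::real. A * exp (M * exp (- 2 * L))) \<longlongrightarrow> A) at_top" by real_asymp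
    then show ?thesis unfolding nG[symmetric]
      using ev by (rule tendsto_lowerbound) auto
  qed
  have lim: "((\<lambda>\<epsilon>. norm (\<Phi> \<zeta>) * exp (- \<epsilon> * Re (E \<zeta>))) \<longlongrightarrow> norm (\<Phi> \<zeta>) * exp (- 0 * Re (E \<zeta>))) (at_right 0)"
    by (intro tendsto_intros)
  have "eventually (\<lambda>\<epsilon>. norm (\<Phi> \<zeta>) * exp (- \<epsilon> * Re (E \<zeta>)) \<le> A) (at_right 0)"
    using eventually_at_right_less[of 0] by eventually_elim (rule eps)
  then show ?thesis
    using tendsto_upperbound[OF lim, of A] by simp
qed (use edge in auto)

text \<open>Under \<open>F \<circ> exp\<close> the imaginary part is the angle and growth of order 2
  in the modulus becomes \<open>exp (2 * Re z)\<close>. The opening stays below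
  \<open>pi / 2\<close>, the critical angle for order 2.\<close>

lemma phragmen_lindelof_sector:
  fixes F :: "complex \<Rightarrow> complex"
  assumes hol: "F holomorphic_on UNIV" and "A \<ge> 0" "M \<ge> 0"
    and growth: "\<And>\<rho> \<theta>. \<rho> > 0 \<Longrightarrow> \<alpha> \<le> \<theta> \<Longrightarrow> \<theta> \<le> \<beta> \<Longrightarrow> norm (F (rcis \<rho> \<theta>)) \<le> A * exp (M * \<rho>\<^sup>2)"
    and edge: "\<And>\<rho> \<theta>. \<rho> > 0 \<Longrightarrow> \<theta> = \<alpha> \<or> \<theta> = \<beta> \<Longrightarrow> norm (F (rcis \<rho> \<theta>)) \<le> A"
    and "\<alpha> < \<beta>" "\<beta> - \<alpha> < pi / 2"
    and "\<rho> > 0" "\<alpha> \<le> \<theta>" "\<theta> \<le> \<beta>"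
  shows "norm (F (rcis \<rho> \<theta>)) \<le> A"
proof -
  have exp: "exp z = rcis (exp (Re z)) (Im z)" for z
    by (simp add: rcis_def exp_eq_polar)
  have "norm ((F \<circ> exp) (Complex (ln \<rho>) \<theta>)) \<le> A"
  proof (rule phragmen_lindelof_strip[where \<Phi>="F \<circ> exp" and M=M and \<alpha>=\<alpha> and \<beta>=\<beta>])
    show "F \<circ> exp holomorphic_on UNIV"
      by (intro holomorphic_on_compose_gen[OF _ hol]) (auto intro: holomorphic_intros)
    fix z :: complex assume "\<alpha> \<le> Im z" "Im z \<le> \<beta>"
    then show "norm ((F \<circ> exp) z) \<le> A * exp (M * exp (2 * Re z))"
      using growth[of "exp (Re z)" "Im z"] by (simp add: exp flip: exp_double)
  qed (use assms edge in \<open>auto simp: exp\<close>)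
  then show ?thesis using assms by (simp add: exp)
qed

text \<open>Converts decay in \<open>sin\<close> into Gaussian decay in the angle. The cubic Taylor
  remainder with \<open>x^2 \<le> 4\<close> costs at most \<open>2/3\<close> of \<open>|x|\<close>,
  which leaves the factor \<open>1/3\<close>.\<close>

lemma sin_sq_ge:
  assumes "\<bar>x\<bar> \<le> pi / 2"
  shows "(x / 3)\<^sup>2 \<le> (sin x)\<^sup>2"
proof -
  have x2: "x\<^sup>2 \<le> 4"
    using assms pi_less_4 abs_le_square_iff[of x 2] by simp
  have "\<bar>sin x - (\<Sum>m<3. sin_coeff m * x ^ m)\<bar> \<le> inverse (fact 3) * \<bar>x\<bar> ^ 3"
    by (rule Maclaurin_sin_bound)
  then have "\<bar>sin x - x\<bar> \<le> \<bar>x\<bar> * (x\<^sup>2 / 6)"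
    by (simp add: eval_nat_numeral sin_coeff_def fact_reduce power2_eq_square abs_mult)
  also have "\<dots> \<le> \<bar>x\<bar> * (4 / 6)" using x2 by (intro mult_left_mono) auto
  finally have "\<bar>x / 3\<bar> \<le> \<bar>sin x\<bar>" by linarith
  then show ?thesis by (simp only: abs_le_square_iff)
qed

text \<open>Between \<open>\<alpha>\<close> and \<open>\<beta>\<close> Phragmen-Lindelof gives the
  exponent \<open>L cos (2 \<theta> - 2 \<psi>) = L - 2 L (sin (\<theta> - \<psi>))^2\<close>.
  Outside, one of the two given exponents is monotone in the angle and hence at most its value at
  \<open>\<alpha>\<close> or \<open>\<beta>\<close>, which is at most \<open>L - \<kappa>\<close>.
  The constant \<open>\<kappa>\<close> is a curvature that suits all three ranges.\<close>

lemma quadrant_bound: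
  fixes F :: "complex \<Rightarrow> complex"
  assumes hol: "F holomorphic_on UNIV" and A: "A \<ge> 0"
    and bound1: "\<And>z. norm (F z) \<le> A * exp (r * (Re z)\<^sup>2 + (Im z)\<^sup>2)"
    and bound2: "\<And>z. norm (F z) \<le> A * exp ((Re z)\<^sup>2 + s * (Im z)\<^sup>2)"
    and rs: "r \<le> 1" "s \<le> 1" and L: "L \<ge> 0"
    and ang: "0 < \<alpha>" "\<alpha> < \<beta>" "\<beta> < pi / 2"
    and tang1: "r * (cos \<alpha>)\<^sup>2 + (sin \<alpha>)\<^sup>2 = L * cos (2 * \<alpha> - 2 * \<psi>)"
    and tang2: "(cos \<beta>)\<^sup>2 + s * (sin \<beta>)\<^sup>2 = L * cos (2 * \<beta> - 2 * \<psi>)"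
    and \<kappa>: "\<kappa> \<ge> 0" "\<kappa> \<le> 2 * L" "\<kappa> \<le> L - L * cos (2 * \<alpha> - 2 * \<psi>)" "\<kappa> \<le> L - L * cos (2 * \<beta> - 2 * \<psi>)"
    and \<rho>: "\<rho> > 0" and \<theta>: "0 \<le> \<theta>" "\<theta> \<le> pi / 2"
  shows "norm (F (rcis \<rho> \<theta>)) \<le> A * exp (L * \<rho>\<^sup>2 - \<kappa> * \<rho>\<^sup>2 * (sin (\<theta> - \<psi>))\<^sup>2)"
proof -
  have b1: "norm (F (rcis \<rho> \<theta>)) \<le> A * exp (\<rho>\<^sup>2 * (r * (cos \<theta>)\<^sup>2 + (sin \<theta>)\<^sup>2))" for \<rho> \<theta>
    using bound1[of "rcis \<rho> \<theta>"] by (simp add: power_mult_distrib algebra_simps)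
  have b2: "norm (F (rcis \<rho> \<theta>)) \<le> A * exp (\<rho>\<^sup>2 * ((cos \<theta>)\<^sup>2 + s * (sin \<theta>)\<^sup>2))" for \<rho> \<theta>
    using bound2[of "rcis \<rho> \<theta>"] by (simp add: power_mult_distrib algebra_simps)
  have out: "norm (F (rcis \<rho> \<theta>)) \<le> A * exp (L * \<rho>\<^sup>2 - \<kappa> * \<rho>\<^sup>2 * (sin (\<theta> - \<psi>))\<^sup>2)"
    if "norm (F (rcis \<rho> \<theta>)) \<le> A * exp (\<rho>\<^sup>2 * T)" "T \<le> L - \<kappa>" for T
  proof -
    have "\<kappa> * (sin (\<theta> - \<psi>))\<^sup>2 \<le> \<kappa>"
      using \<kappa>(1) by (intro mult_left_le) (auto simp: abs_square_le_1)
    then have "\<rho>\<^sup>2 * T \<le> \<rho>\<^sup>2 * (L - \<kappa> * (sin (\<theta> - \<psi>))\<^sup>2)"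
      using that by (intro mult_left_mono) auto
    then have "A * exp (\<rho>\<^sup>2 * T) \<le> A * exp (L * \<rho>\<^sup>2 - \<kappa> * \<rho>\<^sup>2 * (sin (\<theta> - \<psi>))\<^sup>2)"
      using A by (intro mult_left_mono) (auto simp: algebra_simps)
    with that show ?thesis by simp
  qed
  consider "\<theta> \<le> \<alpha>" | "\<alpha> \<le> \<theta>" "\<theta> \<le> \<beta>" | "\<beta> \<le> \<theta>" by linarith
  then show ?thesis
  proof cases
    case 1
    have "cos \<alpha> \<le> cos \<theta>" "0 \<le> cos \<alpha>"
      using 1 ang \<theta> by (auto intro!: cos_monotone_0_pi_le cos_ge_zero)
    then have "(1 - r) * (cos \<alpha>)\<^sup>2 \<le> (1 - r) * (cos \<theta>)\<^sup>2"
      using rs by (intro mult_left_mono power_mono) auto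
    then have "r * (cos \<theta>)\<^sup>2 + (sin \<theta>)\<^sup>2 \<le> r * (cos \<alpha>)\<^sup>2 + (sin \<alpha>)\<^sup>2"
      by (simp add: sin_squared_eq algebra_simps)
    then show ?thesis using \<kappa> tang1 by (intro out[OF b1]) auto
  next
    case 3
    have "sin \<beta> \<le> sin \<theta>" "0 \<le> sin \<beta>"
      using 3 ang \<theta> by (auto intro!: sin_monotone_2pi_le sin_ge_zero)
    then have "(1 - s) * (sin \<beta>)\<^sup>2 \<le> (1 - s) * (sin \<theta>)\<^sup>2"
      using rs by (intro mult_left_mono power_mono) auto
    then have "(cos \<theta>)\<^sup>2 + s * (sin \<theta>)\<^sup>2 \<le> (cos \<beta>)\<^sup>2 + s * (sin \<beta>)\<^sup>2"
      by (simp add: cos_squared_eq algebra_simps)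
    then show ?thesis using \<kappa> tang2 by (intro out[OF b2]) auto
  next
    case 2
    \<comment> \<open>The multiplier removes the exponent
      \<open>L cos (2 \<theta> - 2 \<psi>)\<close>, so that by the two contact equations
      \<open>G\<close> is bounded by \<open>A\<close> on both edges.\<close>
    define G where "G z = F z * exp (- rcis L (- 2 * \<psi>) * z\<^sup>2)" for z
    have nG: "norm (G (rcis \<rho> \<theta>)) = norm (F (rcis \<rho> \<theta>)) * exp (- (\<rho>\<^sup>2 * (L * cos (2 * \<theta> - 2 * \<psi>))))" for \<rho> \<theta>
    proof -
      have "rcis L (- 2 * \<psi>) * (rcis \<rho> \<theta>)\<^sup>2 = rcis (\<rho>\<^sup>2 * L) (2 * \<theta> - 2 * \<psi>)"
        by (simp add: DeMoivre2 rcis_mult algebra_simps)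
      then show ?thesis by (simp add: G_def norm_mult norm_exp_eq_Re)
    qed
    have "norm (G (rcis \<rho> \<theta>)) \<le> A"
    proof (rule phragmen_lindelof_sector[where F=G and M="1 + L" and \<alpha>=\<alpha> and \<beta>=\<beta>])
      show "G holomorphic_on UNIV" unfolding G_def by (intro holomorphic_intros hol)
      show "norm (G (rcis \<rho> \<theta>)) \<le> A * exp ((1 + L) * \<rho>\<^sup>2)" for \<rho> \<theta>
      proof -
        have "r * (cos \<theta>)\<^sup>2 \<le> 1 * (cos \<theta>)\<^sup>2" using rs by (intro mult_right_mono) auto
        then have "r * (cos \<theta>)\<^sup>2 + (sin \<theta>)\<^sup>2 \<le> 1" by (simp add: sin_squared_eq)
        moreover have "- L * cos (2 * \<theta> - 2 * \<psi>) \<le> L"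
          using mult_left_mono[OF cos_ge_minus_one[of "2 * \<theta> - 2 * \<psi>"] L] by simp
        ultimately have "\<rho>\<^sup>2 * ((r * (cos \<theta>)\<^sup>2 + (sin \<theta>)\<^sup>2) - L * cos (2 * \<theta> - 2 * \<psi>)) \<le> \<rho>\<^sup>2 * (1 + L)"
          by (intro mult_left_mono) auto
        then have "exp (\<rho>\<^sup>2 * (r * (cos \<theta>)\<^sup>2 + (sin \<theta>)\<^sup>2)) * exp (- (\<rho>\<^sup>2 * (L * cos (2 * \<theta> - 2 * \<psi>)))) \<le> exp ((1 + L) * \<rho>\<^sup>2)"
          by (simp add: algebra_simps flip: exp_add)
        then have "A * (exp (\<rho>\<^sup>2 * (r * (cos \<theta>)\<^sup>2 + (sin \<theta>)\<^sup>2)) * exp (- (\<rho>\<^sup>2 * (L * cos (2 * \<theta> - 2 * \<psi>))))) \<le> A * exp ((1 + L) * \<rho>\<^sup>2)"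
          using A by (intro mult_left_mono)
        moreover have "norm (G (rcis \<rho> \<theta>)) \<le> A * exp (\<rho>\<^sup>2 * (r * (cos \<theta>)\<^sup>2 + (sin \<theta>)\<^sup>2)) * exp (- (\<rho>\<^sup>2 * (L * cos (2 * \<theta> - 2 * \<psi>))))"
          unfolding nG by (intro mult_right_mono b1) auto
        ultimately show ?thesis by (simp add: mult.assoc)
      qed
      fix \<rho> \<theta> :: real assume "\<theta> = \<alpha> \<or> \<theta> = \<beta>"
      then have "norm (F (rcis \<rho> \<theta>)) \<le> A * exp (\<rho>\<^sup>2 * (L * cos (2 * \<theta> - 2 * \<psi>)))"
        using b1[of \<rho> \<alpha>] b2[of \<rho> \<beta>] tang1 tang2 by auto
      then have "norm (G (rcis \<rho> \<theta>)) \<le> A * exp (\<rho>\<^sup>2 * (L * cos (2 * \<theta> - 2 * \<psi>))) * exp (- (\<rho>\<^sup>2 * (L * cos (2 * \<theta> - 2 * \<psi>))))"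
        unfolding nG by (intro mult_right_mono) auto
      then show "norm (G (rcis \<rho> \<theta>)) \<le> A" by (simp only: mult.assoc exp_minus_inverse mult_1_right)
    qed (use A L ang 2 \<rho> in auto)
    then have "norm (F (rcis \<rho> \<theta>)) \<le> A * exp (\<rho>\<^sup>2 * (L * cos (2 * \<theta> - 2 * \<psi>)))"
      unfolding nG by (simp add: exp_minus field_simps)
    also have "cos (2 * \<theta> - 2 * \<psi>) = 1 - 2 * (sin (\<theta> - \<psi>))\<^sup>2"
      using cos_double_sin[of "\<theta> - \<psi>"] by (simp add: algebra_simps)
    also have "\<rho>\<^sup>2 * (L * (1 - 2 * (sin (\<theta> - \<psi>))\<^sup>2)) = L * \<rho>\<^sup>2 - (2 * L) * \<rho>\<^sup>2 * (sin (\<theta> - \<psi>))\<^sup>2"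
      by (simp add: algebra_simps)
    also have "A * exp \<dots> \<le> A * exp (L * \<rho>\<^sup>2 - \<kappa> * \<rho>\<^sup>2 * (sin (\<theta> - \<psi>))\<^sup>2)"
      using A \<kappa> by (intro mult_left_mono) (auto intro!: mult_right_mono)
    finally show ?thesis .
  qed
qed

section \<open>Taylor coefficients from bounds on circles\<close>

text \<open>Cauchy's formula with the mean of the bound over the circle in place of its maximum, so
  that narrow peaks contribute only their width.\<close>

lemma higher_deriv_circle_bound:
  assumes hol: "F holomorphic_on UNIV" and \<rho>: "\<rho> > 0"
    and le: "\<And>\<theta>. 0 \<le> \<theta> \<Longrightarrow> \<theta> \<le> 2 * pi \<Longrightarrow> norm (F (rcis \<rho> \<theta>)) \<le> B \<theta>"
    and B: "continuous_on UNIV B"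
  shows "norm ((deriv ^^ n) F 0 / fact n) \<le> integral {0..1} (\<lambda>x. B (2 * pi * x)) / \<rho> ^ n"
proof -
  have circ: "circlepath 0 \<rho> x = rcis \<rho> (2 * pi * x)" for x
    by (simp add: circlepath rcis_def cis_conv_exp mult_ac)
  define h where "h x = F (rcis \<rho> (2 * pi * x)) / rcis \<rho> (2 * pi * x) ^ Suc n * (2 * pi * \<i> * rcis \<rho> (2 * pi * x))" for x
  have "((\<lambda>u. F u / (u - 0) ^ Suc n) has_contour_integral (2 * pi) * \<i> / (fact n) * (deriv ^^ n) F 0) (circlepath 0 \<rho>)"
    using \<rho> by (intro Cauchy_has_contour_integral_higher_derivative_circlepath holomorphic_on_imp_continuous_on)
      (auto intro: holomorphic_on_subset[OF hol])
  then have "((\<lambda>x. F (circlepath 0 \<rho> x) / circlepath 0 \<rho> x ^ Suc n * vector_derivative (circlepath 0 \<rho>) (at x within {0..1}))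
      has_integral (2 * pi) * \<i> / (fact n) * (deriv ^^ n) F 0) {0..1}"
    by (simp add: has_contour_integral_def)
  then have hi: "(h has_integral (2 * pi) * \<i> / (fact n) * (deriv ^^ n) F 0) {0..1}"
  proof (rule has_integral_eq[rotated])
    fix x :: real assume "x \<in> {0..1}"
    then show "F (circlepath 0 \<rho> x) / circlepath 0 \<rho> x ^ Suc n * vector_derivative (circlepath 0 \<rho>) (at x within {0..1}) = h x"
      by (simp add: vector_derivative_circlepath01 h_def circ) (simp add: rcis_def cis_conv_exp mult_ac)
  qed
  have cont: "continuous_on {0..1} (\<lambda>x. B (2 * pi * x))"
    by (intro continuous_on_compose2[OF B] continuous_intros) auto
  have "norm (integral {0..1} h) \<le> integral {0..1} (\<lambda>x. 2 * pi / \<rho> ^ n * B (2 * pi * x))"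
  proof (rule integral_norm_bound_integral)
    show "h integrable_on {0..1}" using hi by blast
    show "(\<lambda>x. 2 * pi / \<rho> ^ n * B (2 * pi * x)) integrable_on {0..1}"
      by (intro integrable_continuous_interval continuous_intros cont)
    fix x :: real assume x: "x \<in> {0..1}"
    have "norm (h x) = 2 * pi / \<rho> ^ n * norm (F (rcis \<rho> (2 * pi * x)))"
      using \<rho> by (simp add: h_def norm_mult norm_divide norm_power field_simps)
    also have "\<dots> \<le> 2 * pi / \<rho> ^ n * B (2 * pi * x)"
      using \<rho> x by (intro mult_left_mono le) auto
    finally show "norm (h x) \<le> 2 * pi / \<rho> ^ n * B (2 * pi * x)" .
  qed
  also have "integral {0..1} h = (2 * pi) * \<i> * ((deriv ^^ n) F 0 / fact n)"
    using hi by (simp add: integral_unique)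
  also have "norm ((2 * pi) * \<i> * ((deriv ^^ n) F 0 / fact n)) = 2 * pi * norm ((deriv ^^ n) F 0 / fact n)"
    by (simp add: norm_mult norm_divide)
  also have "integral {0..1} (\<lambda>x. 2 * pi / \<rho> ^ n * B (2 * pi * x)) = 2 * pi * (integral {0..1} (\<lambda>x. B (2 * pi * x)) / \<rho> ^ n)"
    by simp
  finally show ?thesis by (rule mult_left_le_imp_le) simp
qed

text \<open>Enlarge the interval to the whole line. Later \<open>k\<close> is proportional to
  \<open>\<rho>^2\<close>, so each peak yields a factor of order \<open>1 / \<rho>\<close>.\<close>

lemma integral_gaussian_peak_le:
  assumes k: "k > 0"
  shows "integral {0..1} (\<lambda>x. exp (- k * (2 * pi * x - \<theta>)\<^sup>2)) \<le> 1 / (2 * sqrt (pi * k))"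
proof -
  \<comment> \<open>Read off from \<open>- k (2 pi x - \<theta>)^2 = - \<sigma> x^2 / 2 + \<tau> x -
    k \<theta>^2\<close>.\<close>
  define \<sigma> \<tau> where "\<sigma> = 8 * pi\<^sup>2 * k" and "\<tau> = 4 * pi * k * \<theta>"
  have \<sigma>: "\<sigma> > 0" using k by (simp add: \<sigma>_def)
  have eq: "exp (- k * (2 * pi * x - \<theta>)\<^sup>2) = exp (- k * \<theta>\<^sup>2) * exp (- \<sigma> * x\<^sup>2 / 2 + \<tau> * x)" for x
    unfolding exp_add[symmetric]
    by (rule arg_cong[of _ _ exp]) (simp add: \<sigma>_def \<tau>_def power2_eq_square field_simps)
  have int: "integrable lborel (\<lambda>x. exp (- k * (2 * pi * x - \<theta>)\<^sup>2))"
    unfolding eq by (intro integrable_mult_right integrable_gaussian_shift \<sigma>)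
  have hi: "((\<lambda>x. exp (- k * (2 * pi * x - \<theta>)\<^sup>2)) has_integral (LINT x|lborel. exp (- k * (2 * pi * x - \<theta>)\<^sup>2))) UNIV"
    by (rule has_integral_integral_lborel[OF int])
  have "integral {0..1} (\<lambda>x. exp (- k * (2 * pi * x - \<theta>)\<^sup>2)) \<le> integral UNIV (\<lambda>x. exp (- k * (2 * pi * x - \<theta>)\<^sup>2))"
    using hi by (intro integral_subset_le integrable_continuous_interval continuous_intros) auto
  also have "\<dots> = (LINT x|lborel. exp (- k * (2 * pi * x - \<theta>)\<^sup>2))"
    using hi by (rule integral_unique)
  also have "\<dots> = exp (- k * \<theta>\<^sup>2) * (sqrt (2 * pi / \<sigma>) * exp (\<tau>\<^sup>2 / (2 * \<sigma>)))"
    unfolding eq by (simp only: integral_mult_right_zero integral_gaussian_shift[OF \<sigma>])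
  also have "\<tau>\<^sup>2 / (2 * \<sigma>) = k * \<theta>\<^sup>2"
    using k by (simp add: \<sigma>_def \<tau>_def power2_eq_square field_simps)
  also have "exp (- k * \<theta>\<^sup>2) * (sqrt (2 * pi / \<sigma>) * exp (k * \<theta>\<^sup>2)) = sqrt (2 * pi / \<sigma>)"
    by (simp add: exp_minus)
  also have "2 * pi / \<sigma> = 1 / (2\<^sup>2 * (pi * k))"
    by (simp add: \<sigma>_def power2_eq_square)
  also have "sqrt \<dots> = 1 / (2 * sqrt (pi * k))"
    by (simp add: real_sqrt_divide real_sqrt_mult)
  finally show ?thesis .
qed

text \<open>The bound is an equality at \<open>n = 1\<close>, and the induction step amounts to
  \<open>exp 1 \<le> (1 + 1 / n) powr (n + 1 / 2)\<close>, which follows from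
  \<open>ln (1 + 1 / n) \<ge> 2 / (2 n + 1)\<close>.\<close>

lemma fact_le_stirling:
  assumes "n \<ge> 1"
  shows "fact n \<le> exp 1 * sqrt (real n) * (real n / exp 1) ^ n"
  using assms
proof (induction n rule: nat_induct_at_least)
  case (Suc n)
  have n: "real n > 0" using Suc by simp
  have "2 / (2 * real n + 1) \<le> ln (1 + 1 / real n)"
    using ln_approx_bounds[of "1 + 1 / real n" 1] n by (simp add: field_simps)
  then have "1 \<le> (real n + 1 / 2) * ln (1 + 1 / real n)"
    using n by (simp add: field_simps)
  then have "exp 1 \<le> exp ((real n + 1 / 2) * ln (1 + 1 / real n))" by simp
  also have "\<dots> = (1 + 1 / real n) powr (real n + 1 / 2)"
    using n add_pos_pos[of 1 "1 / real n"] by (simp add: powr_def)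
  also have "\<dots> = (1 + 1 / real n) ^ n * sqrt (1 + 1 / real n)"
    using n by (simp add: powr_add powr_realpow powr_half_sqrt add_pos_pos)
  also have "1 + 1 / real n = real (Suc n) / real n" using n by (simp add: field_simps)
  also have "(real (Suc n) / real n) ^ n * sqrt (real (Suc n) / real n) = real (Suc n) ^ n * sqrt (real (Suc n)) / (real n ^ n * sqrt (real n))"
    by (simp add: power_divide real_sqrt_divide)
  finally have e: "exp 1 * (real n ^ n * sqrt (real n)) \<le> real (Suc n) ^ n * sqrt (real (Suc n))"
    using n by (simp add: field_simps)
  have "fact (Suc n) = real (Suc n) * fact n" by simp
  also have "\<dots> \<le> real (Suc n) * (exp 1 * sqrt (real n) * (real n / exp 1) ^ n)"
    by (intro mult_left_mono Suc.IH) auto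
  also have "\<dots> = real (Suc n) / exp 1 ^ n * (exp 1 * (real n ^ n * sqrt (real n)))"
    by (simp add: power_divide)
  also have "\<dots> \<le> real (Suc n) / exp 1 ^ n * (real (Suc n) ^ n * sqrt (real (Suc n)))"
    by (intro mult_left_mono e) auto
  also have "\<dots> = exp 1 * sqrt (real (Suc n)) * (real (Suc n) / exp 1) ^ Suc n"
    by (simp add: power_divide)
  finally show ?case .
qed simp

text \<open>The left side is the central binomial coefficient over \<open>4 ^ k\<close>. Each step
  multiplies it by \<open>(2 k + 1) / (2 k + 2)\<close>, and
  \<open>k (2 k + 2)^2 \<le> (k + 1) (2 k + 1)^2\<close> shows that the right side shrinks at least
  as fast.\<close>

lemma central_ratio_ge:
  assumes "k \<ge> 1"
  shows "fact (2 * k) / (4 ^ k * (fact k)\<^sup>2) \<ge> 1 / (2 * sqrt (real k))"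
  using assms
proof (induction k rule: nat_induct_at_least)
  case (Suc k)
  have k: "real k > 0" using Suc by simp
  have "sqrt (real k * (2 * real k + 2)\<^sup>2) \<le> sqrt ((real k + 1) * (2 * real k + 1)\<^sup>2)"
    by (intro real_sqrt_le_mono) (simp add: power2_eq_square algebra_simps)
  then have s: "sqrt (real k) * (2 * real k + 2) \<le> sqrt (real k + 1) * (2 * real k + 1)"
    by (simp add: real_sqrt_mult)
  have "1 / (2 * sqrt (real (Suc k))) \<le> (2 * real k + 1) / (2 * real k + 2) * (1 / (2 * sqrt (real k)))"
  proof -
    have "1 / (2 * sqrt (real (Suc k))) = (sqrt (real k) * (2 * real k + 2)) / (2 * sqrt (real k + 1) * sqrt (real k) * (2 * real k + 2))"
      using k by (simp add: add.commute)
    also have "\<dots> \<le> (sqrt (real k + 1) * (2 * real k + 1)) / (2 * sqrt (real k + 1) * sqrt (real k) * (2 * real k + 2))"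
      using s k by (intro divide_right_mono) auto
    also have "\<dots> = (2 * real k + 1) / (2 * real k + 2) * (1 / (2 * sqrt (real k)))"
      using k by simp
    finally show ?thesis .
  qed
  also have "\<dots> \<le> (2 * real k + 1) / (2 * real k + 2) * (fact (2 * k) / (4 ^ k * (fact k)\<^sup>2))"
    by (intro mult_left_mono Suc.IH) auto
  also have "\<dots> = fact (2 * Suc k) / (4 ^ Suc k * (fact (Suc k))\<^sup>2)"
  proof -
    have "fact (2 * Suc k) = (2 * real k + 2) * ((2 * real k + 1) * fact (2 * k))"
      by (simp add: algebra_simps)
    moreover have "4 ^ Suc k * (fact (Suc k))\<^sup>2 = (2 * real k + 2) * ((2 * real k + 2) * (4 ^ k * (fact k)\<^sup>2))"
      by (simp add: power2_eq_square algebra_simps)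
    ultimately show ?thesis by (simp only:) simp
  qed
  finally show ?case .
qed (simp add: fact_reduce)

text \<open>Named as a class because it is invariant under \<open>z \<mapsto> - z\<close> and under
  conjugation by \<open>cnj\<close>, which carries estimates from one quadrant to the
  others.\<close>

definition bargmann_growth :: "(complex \<Rightarrow> complex) \<Rightarrow> real \<Rightarrow> real \<Rightarrow> real \<Rightarrow> bool" where
  "bargmann_growth F A r s \<longleftrightarrow> F holomorphic_on UNIV \<and>
     (\<forall>z. norm (F z) \<le> A * exp (r * (Re z)\<^sup>2 + (Im z)\<^sup>2)) \<and>
     (\<forall>z. norm (F z) \<le> A * exp ((Re z)\<^sup>2 + s * (Im z)\<^sup>2))"

text \<open>The symmetries of the class map every quadrant to the first and send the peak
  \<open>\<psi>\<close> to the other three. The quadrant estimate is assumed for the whole class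
  since it is applied to the reflected functions; the three remaining summands are
  nonnegative.\<close>

lemma four_quadrants_bound:
  fixes F :: "complex \<Rightarrow> complex"
  assumes F: "bargmann_growth F A r s"
    and quadrant: "\<And>F \<theta>. bargmann_growth F A r s \<Longrightarrow> 0 \<le> \<theta> \<Longrightarrow> \<theta> \<le> pi / 2 \<Longrightarrow>
       norm (F (rcis \<rho> \<theta>)) \<le> T * exp (- k * (\<theta> - \<psi>)\<^sup>2)"
    and \<theta>: "0 \<le> \<theta>" "\<theta> \<le> 2 * pi"
  shows "norm (F (rcis \<rho> \<theta>)) \<le> (\<Sum>\<eta>\<leftarrow>[\<psi>, pi - \<psi>, pi + \<psi>, 2 * pi - \<psi>]. T * exp (- k * (\<theta> - \<eta>)\<^sup>2))"
proof -
  have hol: "F holomorphic_on UNIV" using F by (simp add: bargmann_growth_def)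
  have "0 \<le> T * exp (- k * (0 - \<psi>)\<^sup>2)"
    by (rule order_trans[OF norm_ge_zero quadrant[OF F, of 0]]) auto
  then have "0 \<le> T" by (simp add: zero_le_mult_iff)
  then have pos: "0 \<le> T * exp (- k * (\<theta> - \<eta>)\<^sup>2)" for \<eta> by simp
  have conj: "bargmann_growth (\<lambda>z. cnj (G (cnj z))) A r s" if "bargmann_growth G A r s" for G
  proof -
    note G = that[unfolded bargmann_growth_def]
    have "(cnj \<circ> G \<circ> cnj) holomorphic_on UNIV"
      by (rule holomorphic_on_compose_cnj_cnj) (use G in \<open>auto intro: holomorphic_on_subset\<close>)
    moreover have "norm (cnj (G (cnj z))) \<le> A * exp (r * (Re z)\<^sup>2 + (Im z)\<^sup>2)"
      "norm (cnj (G (cnj z))) \<le> A * exp ((Re z)\<^sup>2 + s * (Im z)\<^sup>2)" for z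
      using G[THEN conjunct2, THEN conjunct1, THEN spec, of "cnj z"]
        G[THEN conjunct2, THEN conjunct2, THEN spec, of "cnj z"] by simp_all
    ultimately show ?thesis by (simp only: bargmann_growth_def o_def simp_thms)
  qed
  have neg: "bargmann_growth (\<lambda>z. G (- z)) A r s" if "bargmann_growth G A r s" for G
  proof -
    note G = that[unfolded bargmann_growth_def]
    have "(G \<circ> uminus) holomorphic_on UNIV"
      by (rule holomorphic_on_compose_gen[where t=UNIV]) (use G in \<open>auto intro: holomorphic_intros\<close>)
    moreover have "norm (G (- z)) \<le> A * exp (r * (Re z)\<^sup>2 + (Im z)\<^sup>2)"
      "norm (G (- z)) \<le> A * exp ((Re z)\<^sup>2 + s * (Im z)\<^sup>2)" for z
      using G[THEN conjunct2, THEN conjunct1, THEN spec, of "- z"]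
        G[THEN conjunct2, THEN conjunct2, THEN spec, of "- z"] by simp_all
    ultimately show ?thesis by (simp only: bargmann_growth_def o_def simp_thms)
  qed
  consider "\<theta> \<le> pi / 2" | "pi / 2 \<le> \<theta>" "\<theta> \<le> pi" | "pi \<le> \<theta>" "\<theta> \<le> 3 * pi / 2" | "3 * pi / 2 \<le> \<theta>"
    by linarith
  then show ?thesis
  proof cases
    case 1
    then show ?thesis using quadrant[OF F, of \<theta>] \<theta> pos[of \<psi>] pos[of "pi - \<psi>"] pos[of "pi + \<psi>"] pos[of "2 * pi - \<psi>"] by simp
  next
    case 2
    have "- cnj (rcis \<rho> (pi - \<theta>)) = rcis \<rho> \<theta>" by (simp add: complex_eq_iff)
    then have "norm (F (rcis \<rho> \<theta>)) \<le> T * exp (- k * (pi - \<theta> - \<psi>)\<^sup>2)"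
      using quadrant[OF conj[OF neg[OF F]], of "pi - \<theta>"] 2 by simp
    also have "(pi - \<theta> - \<psi>)\<^sup>2 = (\<theta> - (pi - \<psi>))\<^sup>2" by (simp add: power2_eq_square algebra_simps)
    finally show ?thesis using pos[of \<psi>] pos[of "pi + \<psi>"] pos[of "2 * pi - \<psi>"] by simp
  next
    case 3
    have "- rcis \<rho> (\<theta> - pi) = rcis \<rho> \<theta>" by (simp add: complex_eq_iff)
    then have "norm (F (rcis \<rho> \<theta>)) \<le> T * exp (- k * (\<theta> - pi - \<psi>)\<^sup>2)"
      using quadrant[OF neg[OF F], of "\<theta> - pi"] 3 by simp
    also have "\<theta> - pi - \<psi> = \<theta> - (pi + \<psi>)" by simp
    finally show ?thesis using pos[of \<psi>] pos[of "pi - \<psi>"] pos[of "2 * pi - \<psi>"] by simp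
  next
    case 4
    have "cnj (rcis \<rho> (2 * pi - \<theta>)) = rcis \<rho> \<theta>"
      by (simp add: complex_eq_iff cos_diff sin_diff)
    then have "norm (F (rcis \<rho> \<theta>)) \<le> T * exp (- k * (2 * pi - \<theta> - \<psi>)\<^sup>2)"
      using quadrant[OF conj[OF F], of "2 * pi - \<theta>"] 4 \<theta> by simp
    also have "(2 * pi - \<theta> - \<psi>)\<^sup>2 = (\<theta> - (2 * pi - \<psi>))\<^sup>2" by (simp add: power2_eq_square algebra_simps)
    finally show ?thesis using pos[of \<psi>] pos[of "pi - \<psi>"] pos[of "pi + \<psi>"] by simp
  qed
qed

lemma higher_deriv_bound_four_peaks:
  assumes hol: "F holomorphic_on UNIV" and \<rho>: "\<rho> > 0" and T: "T \<ge> 0" and k: "k > 0"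
    and le: "\<And>\<theta>. 0 \<le> \<theta> \<Longrightarrow> \<theta> \<le> 2 * pi \<Longrightarrow>
      norm (F (rcis \<rho> \<theta>)) \<le> (\<Sum>\<eta>\<leftarrow>[\<psi>, pi - \<psi>, pi + \<psi>, 2 * pi - \<psi>]. T * exp (- k * (\<theta> - \<eta>)\<^sup>2))"
  shows "norm ((deriv ^^ n) F 0 / fact n) \<le> 2 * T / sqrt (pi * k) / \<rho> ^ n"
proof -
  let ?g = "\<lambda>\<eta> \<theta>. exp (- k * (\<theta> - \<eta>)\<^sup>2)"
  define B where "B \<theta> = T * (?g \<psi> \<theta> + ?g (pi - \<psi>) \<theta> + ?g (pi + \<psi>) \<theta> + ?g (2 * pi - \<psi>) \<theta>)" for \<theta>
  have "norm ((deriv ^^ n) F 0 / fact n) \<le> integral {0..1} (\<lambda>x. B (2 * pi * x)) / \<rho> ^ n"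
  proof (rule higher_deriv_circle_bound[OF hol \<rho>])
    show "continuous_on UNIV B" unfolding B_def by (intro continuous_intros)
    show "norm (F (rcis \<rho> \<theta>)) \<le> B \<theta>" if "0 \<le> \<theta>" "\<theta> \<le> 2 * pi" for \<theta>
      using le[OF that] by (simp add: B_def algebra_simps)
  qed
  also have "integral {0..1} (\<lambda>x. B (2 * pi * x)) = T * (integral {0..1} (\<lambda>x. ?g \<psi> (2 * pi * x)) + integral {0..1} (\<lambda>x. ?g (pi - \<psi>) (2 * pi * x))
      + integral {0..1} (\<lambda>x. ?g (pi + \<psi>) (2 * pi * x)) + integral {0..1} (\<lambda>x. ?g (2 * pi - \<psi>) (2 * pi * x)))"
    unfolding B_def integral_mult_right
    by (subst Henstock_Kurzweil_Integration.integral_add, (intro integrable_continuous_interval continuous_intros)+)+ simp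
  also have "\<dots> \<le> T * (1 / (2 * sqrt (pi * k)) + 1 / (2 * sqrt (pi * k)) + 1 / (2 * sqrt (pi * k)) + 1 / (2 * sqrt (pi * k)))"
    by (intro mult_left_mono add_mono integral_gaussian_peak_le k T)
  also have "\<dots> = 2 * T / sqrt (pi * k)" by simp
  finally show ?thesis using \<rho> by (simp add: divide_right_mono)
qed

section \<open>The upper estimate\<close>

text \<open>
  At the angle \<open>\<alpha>\<close> the exponent \<open>r u^2 + v^2\<close> touches \<open>Re ((P - i Q) w^2)\<close> with \<open>P = (b - a) / D\<close> and
  \<open>Q = 2 q / D\<close>: their difference is a multiple of \<open>(v - u tan \<alpha>)^2\<close>. Exchanging \<open>a\<close> and \<open>b\<close> and
  reflecting \<open>\<theta>\<close> to \<open>\<pi>/2 - \<theta>\<close> gives the contact with \<open>u^2 + s v^2\<close>.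
\<close>

lemma tangent_angle:
  fixes a b :: real
  defines "D \<equiv> a + b + 2 * a * b" and "q \<equiv> sqrt (a * b * (1 - a * b))"
  defines "\<alpha> \<equiv> arctan (q / (b * (1 + a)))"
  assumes ab: "0 < a" "0 < b" "a * b < 1"
  shows "0 < \<alpha>"
    and "(1 - a) / (1 + a) * (cos \<alpha>)\<^sup>2 + (sin \<alpha>)\<^sup>2 = (b - a) / D * cos (2 * \<alpha>) + 2 * q / D * sin (2 * \<alpha>)"
    and "(1 - a) / (1 + a) * (cos \<alpha>)\<^sup>2 + (sin \<alpha>)\<^sup>2 < sqrt ((a + b - 2 * a * b) / D)"
proof -
  define m where "m = q / (b * (1 + a))"
  define c where "c = (cos \<alpha>)\<^sup>2"
  have D: "D > 0" using ab by (simp add: D_def add_pos_pos)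
  have q: "q > 0" and q2: "q\<^sup>2 = a * b * (1 - a * b)" using ab by (simp_all add: q_def)
  have m: "m > 0" using q ab by (simp add: m_def)
  have m2: "m\<^sup>2 = a * (1 - a * b) / (b * (1 + a)\<^sup>2)"
    using ab by (simp add: m_def power_divide q2 power_mult_distrib) (simp add: power2_eq_square)
  have \<alpha>: "\<alpha> = arctan m" by (simp only: \<alpha>_def m_def)
  show "0 < \<alpha>" using m by (simp add: \<alpha>)
  have sm: "sin \<alpha> = m * cos \<alpha>"
    using tan_arctan[of m] cos_arctan_not_zero[of m] by (simp add: \<alpha> tan_def field_simps)
  have c1: "c * (1 + m\<^sup>2) = 1"
    using sin_cos_squared_add[of \<alpha>] by (simp add: sm c_def power_mult_distrib algebra_simps)
  have lhs: "(1 - a) / (1 + a) * (cos \<alpha>)\<^sup>2 + (sin \<alpha>)\<^sup>2 = c * ((1 - a) / (1 + a) + m\<^sup>2)"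
    by (simp add: sm c_def power_mult_distrib algebra_simps)
  have cos2: "cos (2 * \<alpha>) = c * (1 - m\<^sup>2)"
    unfolding cos_double sm c_def by (simp add: power_mult_distrib algebra_simps)
  have sin2: "sin (2 * \<alpha>) = 2 * m * c"
    unfolding sin_double sm c_def by (simp add: power2_eq_square)
  have "(b - a) / D * cos (2 * \<alpha>) + 2 * q / D * sin (2 * \<alpha>) = c * ((b - a) / D * (1 - m\<^sup>2) + 2 * (2 * q / D) * m)"
    unfolding cos2 sin2 by (simp add: algebra_simps)
  \<comment> \<open>With \<open>P\<close>, \<open>Q\<close> as above and
    \<open>r = (1 - a) / (1 + a)\<close> the claim is
    \<open>(1 + P) m^2 - 2 Q m + (r - P) = 0\<close>. For
    \<open>X = 2 a (1 - a b) / (D (1 + a))\<close> the three terms are \<open>X\<close>,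
    \<open>- 2 X\<close> and \<open>X\<close>; so \<open>m = tan \<alpha>\<close> is a double root,
    which is the tangency.\<close>
  also have "(b - a) / D * (1 - m\<^sup>2) + 2 * (2 * q / D) * m = (1 - a) / (1 + a) + m\<^sup>2"
  proof -
    have "2 * (2 * q / D) * m = 4 * q\<^sup>2 / (D * (b * (1 + a)))"
      by (simp add: m_def power2_eq_square)
    also have "\<dots> = 4 * (a * (1 - a * b)) / (D * (1 + a))"
      using ab D by (simp add: q2)
    finally have 1: "2 * (2 * q / D) * m = 4 * (a * (1 - a * b)) / (D * (1 + a))" .
    have "(1 + (b - a) / D) * m\<^sup>2 = 2 * b * (1 + a) / D * (a * (1 - a * b) / (b * (1 + a)\<^sup>2))"
      unfolding m2 using D by (simp add: D_def field_simps)
    also have "\<dots> = 2 * (a * (1 - a * b)) / (D * (1 + a))"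
      using ab by (simp add: power2_eq_square)
    finally have 2: "(1 + (b - a) / D) * m\<^sup>2 = 2 * (a * (1 - a * b)) / (D * (1 + a))" .
    have 3: "(1 - a) / (1 + a) - (b - a) / D = 2 * (a * (1 - a * b)) / (D * (1 + a))"
    proof -
      have "(1 - a) / (1 + a) - (b - a) / D = ((1 - a) * D - (b - a) * (1 + a)) / (D * (1 + a))"
        using D ab by (simp add: field_simps)
      also have "(1 - a) * D - (b - a) * (1 + a) = 2 * (a * (1 - a * b))"
        by (simp add: D_def algebra_simps)
      finally show ?thesis .
    qed
    have "(b - a) / D * (1 - m\<^sup>2) = (b - a) / D + m\<^sup>2 - (1 + (b - a) / D) * m\<^sup>2"
      by (simp add: algebra_simps)
    then show ?thesis using 1 2 3 by (simp add: add_divide_distrib[symmetric])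
  qed
  finally show "(1 - a) / (1 + a) * (cos \<alpha>)\<^sup>2 + (sin \<alpha>)\<^sup>2 = (b - a) / D * cos (2 * \<alpha>) + 2 * q / D * sin (2 * \<alpha>)"
    unfolding lhs by simp
  define T where "T = a * (1 - a * b) / b"
  define N1 N2 where "N1 = 1 - a\<^sup>2 + T" and "N2 = (1 + a)\<^sup>2 + T"
  have T: "T > 0" using ab by (simp add: T_def)
  have N2: "N2 > 0" using T ab by (simp add: N2_def add_pos_pos)
  have m2T: "m\<^sup>2 = T / (1 + a)\<^sup>2" using ab by (simp add: m2 T_def)
  have "c = (1 + a)\<^sup>2 / N2"
    using c1 ab N2 by (simp add: m2T N2_def field_simps)
  moreover have "(1 - a) / (1 + a) + m\<^sup>2 = N1 / (1 + a)\<^sup>2"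
  proof -
    have "(1 - a) / (1 + a) = (1 - a\<^sup>2) / (1 + a)\<^sup>2"
      using ab by (simp add: divide_simps) (simp add: power2_eq_square algebra_simps)
    then show ?thesis by (simp add: m2T N1_def add_divide_distrib)
  qed
  ultimately have val: "c * ((1 - a) / (1 + a) + m\<^sup>2) = N1 / N2"
    using ab by simp
  \<comment> \<open>With \<open>\<gamma> = a + i sqrt T\<close>, the factors are
    \<open>|1 - \<gamma>|^2\<close> and \<open>|1 + \<gamma>|^2\<close>, and
    \<open>N1 = Re (1 - \<gamma>^2)\<close>. The difference is therefore the square of the imaginary
    part, which makes the inequality strict.\<close>
  have "((1 - a)\<^sup>2 + T) * N2 - N1\<^sup>2 = 4 * a\<^sup>2 * T"
    by (simp add: N1_def N2_def power2_eq_square algebra_simps)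
  then have "N1\<^sup>2 < ((1 - a)\<^sup>2 + T) * N2"
    using T ab by (smt (verit) mult_pos_pos zero_less_power)
  then have "(N1 / N2)\<^sup>2 < ((1 - a)\<^sup>2 + T) / N2"
    using N2 by (simp add: power_divide power2_eq_square field_simps)
  also have "(1 - a)\<^sup>2 + T = (a + b - 2 * a * b) / b"
    using ab by (simp add: T_def power2_eq_square field_simps)
  also have "N2 = D / b"
    using ab by (simp add: N2_def T_def D_def power2_eq_square field_simps)
  also have "(a + b - 2 * a * b) / b / (D / b) = (a + b - 2 * a * b) / D" using ab by simp
  finally have "N1 / (D / b) < sqrt ((a + b - 2 * a * b) / D)"
    by (rule real_less_rsqrt)
  then show "(1 - a) / (1 + a) * (cos \<alpha>)\<^sup>2 + (sin \<alpha>)\<^sup>2 < sqrt ((a + b - 2 * a * b) / D)"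
    unfolding lhs val using \<open>N2 = D / b\<close> by simp
qed

text \<open>From \<open>a b < 1\<close> and the inequality of arithmetic and geometric means,
  \<open>(2 a b)^2 < 4 a b \<le> (a + b)^2\<close>.\<close>

lemma ratio_pos:
  fixes a b :: real
  assumes ab: "0 < a" "0 < b" "a * b < 1"
  shows "(a + b - 2 * a * b) / (a + b + 2 * a * b) > 0"
proof -
  have "(a * b)\<^sup>2 < a * b"
    using ab mult_strict_left_mono[of "a * b" 1 "a * b"] by (simp add: power2_eq_square)
  moreover have "0 \<le> (a - b)\<^sup>2" by simp
  ultimately have "(2 * a * b)\<^sup>2 < (a + b)\<^sup>2" by (simp add: power2_eq_square algebra_simps)
  then have "2 * a * b < a + b" by (rule power2_less_imp_less) (use ab in auto)
  then show ?thesis using ab by (intro divide_pos_pos) (auto intro!: add_pos_pos)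
qed

text \<open>Assembles the contact angles, the quadrant bound and the four peaks. The extra power of
  \<open>\<rho>\<close> in \<open>\<rho> ^ Suc n\<close> is the gain from the width of the
  peaks.\<close>

lemma higher_deriv_bargmann_growth:
  fixes a b :: real
  defines "L \<equiv> sqrt ((a + b - 2 * a * b) / (a + b + 2 * a * b))"
  assumes ab: "0 < a" "0 < b" "a * b < 1" and A: "A \<ge> 0"
    and F: "bargmann_growth F A ((1 - a) / (1 + a)) ((1 - b) / (1 + b))"
  obtains K where "K \<ge> 0" "\<And>n \<rho>. \<rho> > 0 \<Longrightarrow> norm ((deriv ^^ n) F 0 / fact n) \<le> K * (exp (L * \<rho>\<^sup>2) / \<rho> ^ Suc n)"
proof -
  define D where "D = a + b + 2 * a * b"
  define q where "q = sqrt (a * b * (1 - a * b))"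
  define r s where "r = (1 - a) / (1 + a)" and "s = (1 - b) / (1 + b)"
  define P Q where "P = (b - a) / D" and "Q = 2 * q / D"
  have D: "D > 0" using ab by (simp add: D_def add_pos_pos)
  have q: "q > 0" and q2: "q\<^sup>2 = a * b * (1 - a * b)" using ab by (simp_all add: q_def)
  have L: "L > 0" using ratio_pos[OF ab] by (simp add: L_def)
  have LD: "L = sqrt ((a + b - 2 * a * b) / D)" by (simp only: L_def D_def)
  have PQ: "P\<^sup>2 + Q\<^sup>2 = L\<^sup>2"
  proof -
    have "P\<^sup>2 + Q\<^sup>2 = ((b - a)\<^sup>2 + 4 * q\<^sup>2) / D\<^sup>2"
      by (simp add: P_def Q_def power_divide power_mult_distrib add_divide_distrib)
    also have "(b - a)\<^sup>2 + 4 * q\<^sup>2 = (a + b - 2 * a * b) * D"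
      unfolding q2 D_def by (simp add: power2_eq_square algebra_simps)
    also have "\<dots> / D\<^sup>2 = (a + b - 2 * a * b) / D" by (simp add: power2_eq_square)
    also have "\<dots> = L\<^sup>2" using ratio_pos[OF ab] by (simp add: L_def D_def)
    finally show ?thesis .
  qed
  have Q: "Q > 0" using q D by (simp add: Q_def)
  \<comment> \<open>\<open>P + i Q\<close> has modulus \<open>L\<close>, and \<open>2 \<psi>\<close>
    is its argument; \<open>arccos\<close> gives the correct one because
    \<open>Q > 0\<close>.\<close>
  define \<psi> where "\<psi> = arccos (P / L) / 2"
  have "P\<^sup>2 \<le> L\<^sup>2" using PQ zero_le_power2[of Q] by linarith
  then have PL: "\<bar>P / L\<bar> \<le> 1"
    using L by (simp add: abs_divide abs_le_square_iff[symmetric])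
  then have PL': "- 1 \<le> P / L" "P / L \<le> 1" by linarith+
  have \<psi>: "0 \<le> \<psi>" "\<psi> \<le> pi / 2"
    using arccos_bounded[of "P / L"] PL' by (simp_all add: \<psi>_def)
  have cos\<psi>: "L * cos (2 * \<psi>) = P" using PL' L by (simp add: \<psi>_def cos_arccos)
  have sin\<psi>: "L * sin (2 * \<psi>) = Q"
  proof -
    have "sin (2 * \<psi>) = sqrt (1 - (P / L)\<^sup>2)"
      using PL' by (simp add: \<psi>_def sin_arccos)
    also have "1 - (P / L)\<^sup>2 = (Q / L)\<^sup>2"
      using PQ L by (simp add: power_divide field_simps)
    finally show ?thesis using Q L by simp
  qed
  have rot: "L * cos (2 * \<theta> - 2 * \<psi>) = P * cos (2 * \<theta>) + Q * sin (2 * \<theta>)" for \<theta>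
    unfolding cos_diff cos\<psi>[symmetric] sin\<psi>[symmetric] by (simp add: algebra_simps)
  define \<alpha> \<alpha>' where "\<alpha> = arctan (q / (b * (1 + a)))" and "\<alpha>' = arctan (q / (a * (1 + b)))"
  define \<beta> where "\<beta> = pi / 2 - \<alpha>'"
  note ta = tangent_angle[OF ab, folded D_def q_def, folded \<alpha>_def P_def Q_def]
  have sym: "b + a + 2 * b * a = D" "sqrt (b * a * (1 - b * a)) = q" "(a - b) / D = - P" "b * a < 1"
    "b + a - 2 * b * a = a + b - 2 * a * b"
    using ab D by (auto simp: D_def q_def P_def mult.commute field_simps)
  \<comment> \<open>Exchanging \<open>a\<close> and \<open>b\<close> leaves \<open>D\<close> and
    \<open>q\<close>, hence \<open>Q\<close>, unchanged and reverses the sign of \<open>P\<close>;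
    the reflection \<open>\<beta> = pi / 2 - \<alpha>'\<close> compensates for the sign.\<close>
  note tb = tangent_angle[OF ab(2,1) sym(4), unfolded sym(1,2,3,5), folded \<alpha>'_def Q_def]
  have t1: "r * (cos \<alpha>)\<^sup>2 + (sin \<alpha>)\<^sup>2 = L * cos (2 * \<alpha> - 2 * \<psi>)"
    unfolding rot r_def by (rule ta(2))
  have t1': "L * cos (2 * \<alpha> - 2 * \<psi>) < L"
    using ta(3) by (simp only: t1 LD flip: r_def)
  have trig: "cos \<beta> = sin \<alpha>'" "sin \<beta> = cos \<alpha>'" "cos (2 * \<beta>) = - cos (2 * \<alpha>')" "sin (2 * \<beta>) = sin (2 * \<alpha>')"
    by (simp_all add: \<beta>_def cos_diff sin_diff algebra_simps)
  have t2: "(cos \<beta>)\<^sup>2 + s * (sin \<beta>)\<^sup>2 = L * cos (2 * \<beta> - 2 * \<psi>)"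
    unfolding rot s_def trig using tb(2) by simp
  have t2': "L * cos (2 * \<beta> - 2 * \<psi>) < L"
  proof -
    have "(1 - b) / (1 + b) * (cos \<alpha>')\<^sup>2 + (sin \<alpha>')\<^sup>2 = L * cos (2 * \<beta> - 2 * \<psi>)"
      using t2 unfolding trig s_def by simp
    then show ?thesis using tb(3) by (simp only: LD)
  qed
  \<comment> \<open>Equivalent to \<open>tan \<alpha> * tan \<alpha>' < 1\<close>, that is
    \<open>q^2 < a (1 + b) b (1 + a)\<close>.\<close>
  have \<alpha>\<beta>: "\<alpha> < \<beta>"
  proof -
    have "q * q < (a * (1 + b)) * (b * (1 + a))"
    proof -
      have "0 < a * b * (a + b + 2 * (a * b))" using ab by (intro mult_pos_pos add_pos_pos) auto
      moreover have "(a * (1 + b)) * (b * (1 + a)) = q * q + a * b * (a + b + 2 * (a * b))"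
        using q2 by (simp add: power2_eq_square algebra_simps)
      ultimately show ?thesis by linarith
    qed
    then have "q / (b * (1 + a)) < 1 / (q / (a * (1 + b)))"
      using q ab by (simp add: divide_less_eq less_divide_eq add_pos_pos mult.commute mult.left_commute)
    then have "\<alpha> < arctan (1 / (q / (a * (1 + b))))" by (simp only: \<alpha>_def arctan_less_iff)
    also have "\<dots> = \<beta>"
    proof -
      define y where "y = q / (a * (1 + b))"
      have "y > 0" using q ab by (simp add: y_def)
      then have "arctan (1 / y) = pi / 2 - arctan y" using arctan_inverse[of y] by (simp add: inverse_eq_divide)
      then show ?thesis by (simp only: \<beta>_def \<alpha>'_def y_def)
    qed
    finally show ?thesis .
  qed
  \<comment> \<open>Positive because the exponents at both contact angles lie strictly below
    \<open>L\<close>.\<close>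
  define \<kappa> where "\<kappa> = Min {2 * L, L - L * cos (2 * \<alpha> - 2 * \<psi>), L - L * cos (2 * \<beta> - 2 * \<psi>)}"
  have \<kappa>: "\<kappa> > 0" "\<kappa> \<le> 2 * L" "\<kappa> \<le> L - L * cos (2 * \<alpha> - 2 * \<psi>)" "\<kappa> \<le> L - L * cos (2 * \<beta> - 2 * \<psi>)"
    using L t1' t2' by (auto simp: \<kappa>_def)
  have rs: "r \<le> 1" "s \<le> 1" using ab by (auto simp: r_def s_def)
  \<comment> \<open>The 9 is the square of the 3 lost in \<open>sin_sq_ge\<close>.\<close>
  define K where "K = 2 * A / sqrt (pi * \<kappa> / 9)"
  show ?thesis
  proof
    show "K \<ge> 0" using A \<kappa> by (simp add: K_def)
    fix n :: nat and \<rho> :: real assume \<rho>: "\<rho> > 0"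
    have quadrant: "norm (G (rcis \<rho> \<theta>)) \<le> (A * exp (L * \<rho>\<^sup>2)) * exp (- (\<kappa> * \<rho>\<^sup>2 / 9) * (\<theta> - \<psi>)\<^sup>2)"
      if G: "bargmann_growth G A r s" and \<theta>: "0 \<le> \<theta>" "\<theta> \<le> pi / 2" for G \<theta>
    proof -
      have "norm (G (rcis \<rho> \<theta>)) \<le> A * exp (L * \<rho>\<^sup>2 - \<kappa> * \<rho>\<^sup>2 * (sin (\<theta> - \<psi>))\<^sup>2)"
        using G by (intro quadrant_bound[OF _ A _ _ rs less_imp_le[OF L] ta(1) \<alpha>\<beta> _ t1 t2 less_imp_le[OF \<kappa>(1)] \<kappa>(2-4) \<rho> \<theta>])
          (use tb(1) in \<open>auto simp: bargmann_growth_def \<beta>_def\<close>)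
      also have "\<dots> \<le> A * exp (L * \<rho>\<^sup>2 - \<kappa> * \<rho>\<^sup>2 * ((\<theta> - \<psi>) / 3)\<^sup>2)"
      proof -
        have "\<bar>\<theta> - \<psi>\<bar> \<le> pi / 2" using \<theta> \<psi> by linarith
        from sin_sq_ge[OF this] show ?thesis
          using A \<kappa>(1) by (intro mult_left_mono) (auto intro!: mult_left_mono)
      qed
      also have "L * \<rho>\<^sup>2 - \<kappa> * \<rho>\<^sup>2 * ((\<theta> - \<psi>) / 3)\<^sup>2 = L * \<rho>\<^sup>2 + - (\<kappa> * \<rho>\<^sup>2 / 9) * (\<theta> - \<psi>)\<^sup>2"
        by (simp add: power_divide)
      finally show ?thesis by (simp only: exp_add mult.assoc)
    qed
    have "norm ((deriv ^^ n) F 0 / fact n) \<le> 2 * (A * exp (L * \<rho>\<^sup>2)) / sqrt (pi * (\<kappa> * \<rho>\<^sup>2 / 9)) / \<rho> ^ n"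
    proof (rule higher_deriv_bound_four_peaks)
      show "F holomorphic_on UNIV" using F by (simp add: bargmann_growth_def)
      show "norm (F (rcis \<rho> \<theta>)) \<le> (\<Sum>\<eta>\<leftarrow>[\<psi>, pi - \<psi>, pi + \<psi>, 2 * pi - \<psi>]. A * exp (L * \<rho>\<^sup>2) * exp (- (\<kappa> * \<rho>\<^sup>2 / 9) * (\<theta> - \<eta>)\<^sup>2))"
        if "0 \<le> \<theta>" "\<theta> \<le> 2 * pi" for \<theta>
        by (rule four_quadrants_bound[OF F[folded r_def s_def] _ that]) (rule quadrant)
    qed (use \<rho> \<kappa> A in auto)
    also have "sqrt (pi * (\<kappa> * \<rho>\<^sup>2 / 9)) = sqrt (pi * \<kappa> / 9) * \<rho>"
      using \<rho> by (simp add: real_sqrt_mult real_sqrt_divide)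
    also have "2 * (A * exp (L * \<rho>\<^sup>2)) / (sqrt (pi * \<kappa> / 9) * \<rho>) / \<rho> ^ n = K * (exp (L * \<rho>\<^sup>2) / \<rho> ^ Suc n)"
      by (simp add: K_def)
    finally show "norm ((deriv ^^ n) F 0 / fact n) \<le> K * (exp (L * \<rho>\<^sup>2) / \<rho> ^ Suc n)" .
  qed
qed

section \<open>Evaluation at the optimal radius\<close>

lemma powr_neg_half_sq: "x > 0 \<Longrightarrow> (x powr (- 1 / 2))\<^sup>2 = 1 / (x::real)"
  by (simp add: power2_eq_square powr_minus_divide flip: powr_add)

lemma decay_sq:
  assumes "n \<ge> 1" "L > 0"
  shows "(real n powr (- 1 / 4) * L powr (real n / 2))\<^sup>2 = L ^ n / sqrt (real n)"
proof -
  have "(real n powr (- 1 / 4))\<^sup>2 = real n powr (- 1 / 2)" by (simp add: power2_eq_square flip: powr_add)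
  also have "\<dots> = 1 / sqrt (real n)" using assms by (simp add: powr_minus_divide powr_half_sqrt)
  finally have 1: "(real n powr (- 1 / 4))\<^sup>2 = 1 / sqrt (real n)" .
  have "(L powr (real n / 2))\<^sup>2 = L powr real n" by (simp add: power2_eq_square flip: powr_add)
  with 1 show ?thesis using assms by (simp add: power_mult_distrib powr_realpow)
qed

text \<open>This \<open>\<rho>\<close> minimizes \<open>exp (L \<rho>^2) / \<rho> ^ n\<close>.
  Squares are compared to avoid fractional powers: there the powers of \<open>exp 1\<close> and of
  \<open>n\<close> cancel against the Stirling bound except for \<open>sqrt n / n\<close>, whose
  square root is \<open>n powr (- 1 / 4)\<close>.\<close>

lemma saddle_point_value_le:
  fixes L :: real
  assumes n: "n \<ge> 1" and L: "L > 0"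
  defines "\<rho> \<equiv> sqrt (real n / (2 * L))"
  shows "(2 ^ n * fact n * sqrt pi) powr (- 1 / 2) * (fact n * (exp (L * \<rho>\<^sup>2) / \<rho> ^ Suc n))
    \<le> sqrt (2 * exp 1 * L / sqrt pi) * (real n powr (- 1 / 4) * L powr (real n / 2))"
proof (rule power2_le_imp_le)
  have \<rho>2: "\<rho>\<^sup>2 = real n / (2 * L)" using L by (simp add: \<rho>_def)
  have exp: "(exp (L * \<rho>\<^sup>2))\<^sup>2 = exp 1 ^ n"
    using L by (simp add: \<rho>2 flip: exp_double exp_of_nat_mult)
  have pow: "(\<rho> ^ Suc n)\<^sup>2 = (real n / (2 * L)) ^ Suc n"
    by (simp only: \<rho>2 flip: power_mult power_commutes[of 2]) (simp only: power_mult \<rho>2 mult.commute[of "Suc n" 2])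
  have "((2 ^ n * fact n * sqrt pi) powr (- 1 / 2) * (fact n * (exp (L * \<rho>\<^sup>2) / \<rho> ^ Suc n)))\<^sup>2
      = 1 / (2 ^ n * fact n * sqrt pi) * ((fact n)\<^sup>2 * (exp 1 ^ n / (real n / (2 * L)) ^ Suc n))"
    unfolding power_mult_distrib power_divide[of "exp _"] exp pow
    by (subst powr_neg_half_sq) auto
  also have "\<dots> = fact n * (exp 1 ^ n * 2 * L ^ Suc n / (sqrt pi * real n ^ Suc n))"
    using L n by (simp add: power2_eq_square power_divide power_mult_distrib)
  also have "\<dots> \<le> (exp 1 * sqrt (real n) * (real n / exp 1) ^ n) * (exp 1 ^ n * 2 * L ^ Suc n / (sqrt pi * real n ^ Suc n))"
    using L by (intro mult_right_mono fact_le_stirling n) auto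
  also have "\<dots> = 2 * exp 1 * L / sqrt pi * (L ^ n * (sqrt (real n) / real n))"
    using n by (simp add: power_divide)
  also have "sqrt (real n) / real n = 1 / sqrt (real n)"
    using n by (simp add: divide_eq_eq real_div_sqrt)
  also have "2 * exp 1 * L / sqrt pi * (L ^ n * (1 / sqrt (real n)))
      = (sqrt (2 * exp 1 * L / sqrt pi) * (real n powr (- 1 / 4) * L powr (real n / 2)))\<^sup>2"
    unfolding power_mult_distrib[of "sqrt _"] decay_sq[OF n L] using L by simp
  finally show "((2 ^ n * fact n * sqrt pi) powr (- 1 / 2) * (fact n * (exp (L * \<rho>\<^sup>2) / \<rho> ^ Suc n)))\<^sup>2
      \<le> (sqrt (2 * exp 1 * L / sqrt pi) * (real n powr (- 1 / 4) * L powr (real n / 2)))\<^sup>2" .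
qed (use L in auto)

text \<open>The second bound is the first one for \<open>fourier f\<close> at
  \<open>\<i> * z\<close>, where real and imaginary parts trade places up to sign.\<close>

lemma Eab_bargmann_growth:
  assumes ab: "0 < a" "0 < b" and f: "f \<in> Eab a b"
  obtains A where "A \<ge> 0" "bargmann_growth (bargmann f) A ((1 - a) / (1 + a)) ((1 - b) / (1 + b))"
proof -
  obtain C where int: "integrable lborel f" and C: "\<And>x. norm (f x) \<le> C * gauss a x" "\<And>\<xi>. norm (fourier f \<xi>) \<le> C * gauss b \<xi>"
    using f by (auto simp: Eab_def)
  have [measurable]: "f \<in> borel_measurable lborel" using int by auto
  have "0 \<le> C" using order_trans[OF norm_ge_zero C(1)[of 0]] by (simp add: gauss_def)
  define A where "A = max (C * sqrt (2 * pi / (1 + a))) (C * sqrt (2 * pi / (1 + b)))"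
  show ?thesis
  proof
    show "A \<ge> 0" using \<open>0 \<le> C\<close> ab by (simp add: A_def le_max_iff_disj)
    have "norm (bargmann f z) \<le> A * exp ((1 - a) / (1 + a) * (Re z)\<^sup>2 + (Im z)\<^sup>2)" for z
      using ab by (intro order_trans[OF norm_bargmann_le[OF _ C(1)] mult_right_mono]) (auto simp: A_def)
    moreover have "norm (bargmann f z) \<le> A * exp ((Re z)\<^sup>2 + (1 - b) / (1 + b) * (Im z)\<^sup>2)" for z
    proof -
      have "norm (bargmann (fourier f) (\<i> * z)) \<le> A * exp ((1 - b) / (1 + b) * (Re (\<i> * z))\<^sup>2 + (Im (\<i> * z))\<^sup>2)"
        using ab by (intro order_trans[OF norm_bargmann_le[OF _ C(2)] mult_right_mono]) (auto simp: A_def)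
      then show ?thesis by (simp add: bargmann_fourier[OF int, of z] add.commute)
    qed
    ultimately show "bargmann_growth (bargmann f) A ((1 - a) / (1 + a)) ((1 - b) / (1 + b))"
      using ab by (auto simp: bargmann_growth_def intro!: bargmann_entire[OF _ _ C(1)])
  qed
qed

lemma hermite_coeff_upper:
  fixes a b :: real
  defines "L \<equiv> sqrt ((a + b - 2 * a * b) / (a + b + 2 * a * b))"
  assumes ab: "0 < a" "0 < b" "a * b < 1" and f: "f \<in> Eab a b"
  obtains K where "\<And>n. n \<ge> 1 \<Longrightarrow> norm (hermite_coeff f n) \<le> K * (real n powr (- 1 / 4) * L powr (real n / 2))"
proof -
  have L: "L > 0" using ratio_pos[OF ab] by (simp add: L_def)
  obtain C where int: "integrable lborel f" and C: "\<And>x. norm (f x) \<le> C * gauss a x"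
    using f by (auto simp: Eab_def)
  have [measurable]: "f \<in> borel_measurable lborel" using int by auto
  obtain A where "A \<ge> 0" "bargmann_growth (bargmann f) A ((1 - a) / (1 + a)) ((1 - b) / (1 + b))"
    using Eab_bargmann_growth[OF ab(1,2) f] by blast
  from higher_deriv_bargmann_growth[OF ab this] obtain K where K: "K \<ge> 0"
    "\<And>n \<rho>. \<rho> > 0 \<Longrightarrow> norm ((deriv ^^ n) (bargmann f) 0 / fact n) \<le> K * (exp (L * \<rho>\<^sup>2) / \<rho> ^ Suc n)"
    unfolding L_def by blast
  show ?thesis
  proof
    fix n :: nat assume n: "n \<ge> 1"
    define \<rho> where "\<rho> = sqrt (real n / (2 * L))"
    have \<rho>: "\<rho> > 0" using n L by (simp add: \<rho>_def)
    define c where "c = (2 ^ n * fact n * sqrt pi) powr (- 1 / 2)"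
    have "norm (hermite_coeff f n) = c * (fact n * norm ((deriv ^^ n) (bargmann f) 0 / fact n))"
      using ab by (subst hermite_coeff_bargmann[OF _ _ C]) (auto simp: norm_mult norm_divide c_def)
    also have "\<dots> \<le> c * (fact n * (K * (exp (L * \<rho>\<^sup>2) / \<rho> ^ Suc n)))"
      by (intro mult_left_mono K(2) \<rho>) (auto simp: c_def)
    also have "\<dots> = K * (c * (fact n * (exp (L * \<rho>\<^sup>2) / \<rho> ^ Suc n)))" by (simp only: mult_ac)
    also have "\<dots> \<le> K * (sqrt (2 * exp 1 * L / sqrt pi) * (real n powr (- 1 / 4) * L powr (real n / 2)))"
      unfolding c_def \<rho>_def by (intro mult_left_mono saddle_point_value_le n L K(1))
    finally show "norm (hermite_coeff f n) \<le> K * sqrt (2 * exp 1 * L / sqrt pi) * (real n powr (- 1 / 4) * L powr (real n / 2))"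
      by (simp only: mult.assoc)
  qed
qed

section \<open>Sharpness\<close>

text \<open>The Fourier transform is a multiple of \<open>exp (- \<xi>^2 / (2 \<gamma>))\<close>
  with \<open>\<gamma> = a + i t\<close>, and the hypothesis on \<open>t\<close> says
  \<open>Re (1 / \<gamma>) = b\<close>. Both decay conditions hold with equality up to a
  constant.\<close>

lemma chirped_gaussian_in_Eab:
  fixes a b t :: real
  assumes ab: "0 < a" "0 < b" and t: "b * (a\<^sup>2 + t\<^sup>2) = a"
  shows "(\<lambda>x. exp (- Complex a t * of_real (x\<^sup>2) / 2)) \<in> Eab a b"
proof -
  define \<gamma> where "\<gamma> = Complex a t"
  define M where "M = (LINT x|lborel. exp (- \<gamma> * of_real (x\<^sup>2) / 2))"
  define f where "f x = exp (- \<gamma> * of_real (x\<^sup>2) / 2)" for x :: real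
  have \<gamma>: "Re \<gamma> > 0" using ab by (simp add: \<gamma>_def)
  have Re_inv: "Re (1 / (2 * \<gamma>)) = b / 2"
  proof -
    define S where "S = a\<^sup>2 + t\<^sup>2"
    have S: "S > 0" using ab by (simp add: S_def add_pos_nonneg)
    have "Re (1 / (2 * \<gamma>)) = 2 * a / ((2 * a)\<^sup>2 + (2 * t)\<^sup>2)"
      by (simp add: Re_divide \<gamma>_def)
    also have "(2 * a)\<^sup>2 + (2 * t)\<^sup>2 = 4 * S" by (simp add: S_def power_mult_distrib)
    also have "2 * a = 2 * (b * S)" by (simp only: t S_def)
    also have "2 * (b * S) / (4 * S) = b / 2" using S by simp
    finally show ?thesis .
  qed
  have int: "integrable lborel f"
    using integrable_complex_gaussian[OF \<gamma>, of 0] by (simp add: f_def[abs_def])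
  have nf: "norm (f x) = gauss a x" for x
    by (simp add: f_def gauss_def norm_exp_eq_Re \<gamma>_def)
  have four: "fourier f \<xi> = of_real (1 / sqrt (2 * pi)) * (M * exp ((- \<i> * of_real \<xi>)\<^sup>2 / (2 * \<gamma>)))" for \<xi>
  proof -
    have "(LINT x|lborel. f x * exp (- \<i> * of_real (\<xi> * x))) = (LINT x|lborel. exp (- \<gamma> * of_real (x\<^sup>2) / 2 + (- \<i> * of_real \<xi>) * of_real x))"
      unfolding f_def exp_add by (simp add: mult.assoc)
    then show ?thesis
      unfolding fourier_def complex_gaussian_integral_exp[OF \<gamma>] M_def by simp
  qed
  have nfour: "norm (fourier f \<xi>) = norm M / sqrt (2 * pi) * gauss b \<xi>" for \<xi>
  proof -
    have "(- \<i> * of_real \<xi>)\<^sup>2 / (2 * \<gamma>) = of_real (- (\<xi>\<^sup>2)) * (1 / (2 * \<gamma>))"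
      by (simp add: power_mult_distrib)
    then have "Re ((- \<i> * of_real \<xi>)\<^sup>2 / (2 * \<gamma>)) = - (\<xi>\<^sup>2) * (b / 2)"
      by (simp only: times_complex.sel Re_complex_of_real Im_complex_of_real Re_inv mult_zero_left diff_zero)
    then show ?thesis
      unfolding four by (simp add: norm_mult norm_divide norm_exp_eq_Re gauss_def mult.commute)
  qed
  define C where "C = max 1 (norm M / sqrt (2 * pi))"
  have "norm (f x) \<le> C * gauss a x" for x
    unfolding nf using mult_right_mono[of 1 C "gauss a x"] by (simp add: C_def gauss_def)
  moreover have "norm (fourier f \<xi>) \<le> C * gauss b \<xi>" for \<xi>
    unfolding nfour by (intro mult_right_mono) (simp_all add: C_def gauss_def)
  ultimately have "f \<in> Eab a b" using int by (auto simp: Eab_def)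
  then show ?thesis by (simp add: f_def[abs_def] \<gamma>_def)
qed

text \<open>The Gaussian integral contributes \<open>2 w^2 / (1 + \<gamma>)\<close>; subtracting
  \<open>w^2\<close> leaves the Cayley transform of \<open>\<gamma>\<close> as the
  coefficient.\<close>

lemma bargmann_gaussian:
  assumes "Re \<gamma> > - 1"
  shows "bargmann (\<lambda>x. exp (- \<gamma> * of_real (x\<^sup>2) / 2)) w =
    (LINT x|lborel. exp (- (1 + \<gamma>) * of_real (x\<^sup>2) / 2)) * exp ((1 - \<gamma>) / (1 + \<gamma>) * w\<^sup>2)"
proof -
  have re: "Re (1 + \<gamma>) > 0" using assms by simp
  then have nz: "1 + \<gamma> \<noteq> 0" by (metis less_irrefl zero_complex.sel(1))
  have "2 + \<gamma> * 2 = 2 * (1 + \<gamma>)" by simp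
  then have nz2: "2 + \<gamma> * 2 \<noteq> 0" using nz by (simp only: mult_eq_0_iff) simp
  have eq: "exp (- \<gamma> * of_real (x\<^sup>2) / 2) * of_real (exp (- x\<^sup>2 / 2)) * exp (2 * of_real x * w - w\<^sup>2)
      = exp (- (w\<^sup>2)) * exp (- (1 + \<gamma>) * of_real (x\<^sup>2) / 2 + 2 * w * of_real x)" for x
    unfolding exp_of_real[symmetric] exp_add[symmetric]
    by (rule arg_cong[of _ _ exp]) (simp add: field_simps)
  have "bargmann (\<lambda>x. exp (- \<gamma> * of_real (x\<^sup>2) / 2)) w =
      exp (- (w\<^sup>2)) * ((LINT x|lborel. exp (- (1 + \<gamma>) * of_real (x\<^sup>2) / 2)) * exp ((2 * w)\<^sup>2 / (2 * (1 + \<gamma>))))"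
    unfolding bargmann_def eq integral_mult_right_zero complex_gaussian_integral_exp[OF re] ..
  also have "\<dots> = (LINT x|lborel. exp (- (1 + \<gamma>) * of_real (x\<^sup>2) / 2)) * exp (- (w\<^sup>2) + (2 * w)\<^sup>2 / (2 * (1 + \<gamma>)))"
    unfolding exp_add by (simp only: mult_ac)
  also have "- (w\<^sup>2) + (2 * w)\<^sup>2 / (2 * (1 + \<gamma>)) = (1 - \<gamma>) / (1 + \<gamma>) * w\<^sup>2"
    using nz nz2 by (simp add: power_mult_distrib divide_simps) (simp add: algebra_simps)
  finally show ?thesis .
qed

lemma higher_deriv_exp_square:
  fixes M l :: complex
  shows "(deriv ^^ (2 * k)) (\<lambda>w. M * exp (l * w\<^sup>2)) 0 / fact (2 * k) = M * l ^ k / fact k"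
proof -
  \<comment> \<open>Zeros at odd indices turn the exponential series in \<open>w^2\<close> into a
    full power series in \<open>w\<close>.\<close>
  define c where "c n = (if even n then M * l ^ (n div 2) / fact (n div 2) else 0)" for n
  have "(\<lambda>n. c n * w ^ n) sums (M * exp (l * w\<^sup>2))" for w
  proof -
    have "(\<lambda>k. M * ((l * w\<^sup>2) ^ k /\<^sub>R fact k)) sums (M * exp (l * w\<^sup>2))"
      by (intro sums_mult exp_converges)
    also have "(\<lambda>k. M * ((l * w\<^sup>2) ^ k /\<^sub>R fact k)) = (\<lambda>k. c (2 * k) * w ^ (2 * k))"
    proof
      fix k
      have "(l * w\<^sup>2) ^ k = l ^ k * w ^ (2 * k)" by (simp only: power_mult_distrib power_mult)
      then show "M * ((l * w\<^sup>2) ^ k /\<^sub>R fact k) = c (2 * k) * w ^ (2 * k)"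
        by (simp add: c_def scaleR_conv_of_real divide_inverse mult_ac del: power_even_eq)
    qed
    finally show ?thesis
      by (subst (asm) sums_mono_reindex[where g="\<lambda>k. 2 * k" and f="\<lambda>n. c n * w ^ n"])
        (auto simp: strict_mono_def c_def)
  qed
  then have "(\<lambda>w. M * exp (l * w\<^sup>2)) has_fps_expansion Abs_fps c"
    by (intro has_fps_expansionI) simp
  from fps_nth_fps_expansion[OF this, of "2 * k"] show ?thesis by (simp add: c_def)
qed

text \<open>For the chirped Gaussian the Bargmann transform is \<open>M exp (l w^2)\<close> with
  \<open>|l| = L\<close>, so the even coefficients are explicit and the central binomial bound
  supplies \<open>n powr (- 1 / 4)\<close>.\<close>

lemma hermite_coeff_lower:
  fixes a b :: real
  defines "L \<equiv> sqrt ((a + b - 2 * a * b) / (a + b + 2 * a * b))"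
  assumes ab: "0 < a" "0 < b" "a * b < 1"
  obtains f c where "f \<in> Eab a b" "c > 0"
    "\<And>n. n \<ge> 2 \<Longrightarrow> even n \<Longrightarrow> c * (real n powr (- 1 / 4) * L powr (real n / 2)) \<le> norm (hermite_coeff f n)"
proof -
  have L: "L > 0" using ratio_pos[OF ab] by (simp add: L_def)
  \<comment> \<open>The nonnegative solution of \<open>b (a^2 + t^2) = a\<close>; the root is real
    because \<open>a b < 1\<close>.\<close>
  define t where "t = sqrt (a * (1 - a * b) / b)"
  have t2: "t\<^sup>2 = a * (1 - a * b) / b" using ab by (simp add: t_def)
  have t: "b * (a\<^sup>2 + t\<^sup>2) = a" unfolding t2 using ab by (simp add: power2_eq_square field_simps)
  define \<gamma> where "\<gamma> = Complex a t"
  define f where "f x = exp (- \<gamma> * of_real (x\<^sup>2) / 2)" for x :: real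
  have f: "f \<in> Eab a b" using chirped_gaussian_in_Eab[OF ab(1,2) t] by (simp add: f_def[abs_def] \<gamma>_def)
  define M where "M = (LINT x|lborel. exp (- (1 + \<gamma>) * of_real (x\<^sup>2) / 2))"
  \<comment> \<open>\<open>M\<close> cannot vanish, since
    \<open>M^2 (1 + \<gamma>) = 2 pi\<close>.\<close>
  have M: "norm M > 0"
    using complex_gaussian_integral_sq[of "1 + \<gamma>"] ab by (auto simp: M_def \<gamma>_def)
  define l where "l = (1 - \<gamma>) / (1 + \<gamma>)"
  have nl: "norm l = L"
  proof -
    have "(norm l)\<^sup>2 = (norm (1 - \<gamma>))\<^sup>2 / (norm (1 + \<gamma>))\<^sup>2" by (simp add: l_def norm_divide power_divide)
    also have "(norm (1 - \<gamma>))\<^sup>2 = (a + b - 2 * a * b) / b"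
      using ab by (simp add: cmod_power2 \<gamma>_def t2) (simp add: power2_eq_square field_simps)
    also have "(norm (1 + \<gamma>))\<^sup>2 = (a + b + 2 * a * b) / b"
      using ab by (simp add: cmod_power2 \<gamma>_def t2) (simp add: power2_eq_square field_simps)
    also have "(a + b - 2 * a * b) / b / ((a + b + 2 * a * b) / b) = (a + b - 2 * a * b) / (a + b + 2 * a * b)"
      using ab by simp
    finally show ?thesis unfolding L_def by (metis norm_ge_zero real_sqrt_unique)
  qed
  have barg: "bargmann f = (\<lambda>w. M * exp (l * w\<^sup>2))"
    using bargmann_gaussian[of \<gamma>] ab by (auto simp: f_def[abs_def] M_def l_def \<gamma>_def)
  define c where "c = norm M / sqrt (2 * sqrt pi)"
  have "c * (real n powr (- 1 / 4) * L powr (real n / 2)) \<le> norm (hermite_coeff f n)" if n: "n \<ge> 2" "even n" for n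
  proof -
    obtain k where k: "n = 2 * k" using n by auto
    have k1: "k \<ge> 1" using n k by simp
    have int: "integrable lborel f" and nf: "\<And>x. norm (f x) \<le> 1 * gauss a x"
      using f by (auto simp: Eab_def f_def norm_exp_eq_Re gauss_def \<gamma>_def)
    have [measurable]: "f \<in> borel_measurable lborel" using int by auto
    have "(deriv ^^ n) (bargmann f) 0 = fact n * (M * l ^ k / fact k)"
      using higher_deriv_exp_square[of k M l] by (simp add: barg k field_simps)
    then have coeff: "norm (hermite_coeff f n) = (2 ^ n * fact n * sqrt pi) powr (- 1 / 2) * (fact n * (norm M * L ^ k / fact k))"
      using ab by (subst hermite_coeff_bargmann[OF _ _ nf]) (auto simp: norm_mult norm_divide norm_power nl)
    have "(c * (real n powr (- 1 / 4) * L powr (real n / 2)))\<^sup>2 = (norm M)\<^sup>2 * L ^ n / sqrt pi * (1 / (2 * sqrt (real n)))"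
      using n L unfolding power_mult_distrib[of c] by (subst decay_sq) (auto simp: c_def power_divide)
    also have "\<dots> \<le> (norm M)\<^sup>2 * L ^ n / sqrt pi * (1 / (2 * sqrt (real k)))"
      using L k1 k by (intro mult_left_mono divide_left_mono) auto
    also have "\<dots> \<le> (norm M)\<^sup>2 * L ^ n / sqrt pi * (fact (2 * k) / (4 ^ k * (fact k)\<^sup>2))"
      using L by (intro mult_left_mono central_ratio_ge k1) auto
    also have "\<dots> = 1 / (2 ^ n * fact n * sqrt pi) * ((fact n)\<^sup>2 * ((norm M)\<^sup>2 * (L ^ k)\<^sup>2 / (fact k)\<^sup>2))"
    proof -
      have "(4::real) ^ k = 2 ^ n" by (simp add: k power_mult)
      moreover have "(L ^ k)\<^sup>2 = L ^ n" by (simp add: k mult.commute flip: power_mult)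
      ultimately show ?thesis unfolding k[symmetric] by (simp add: power2_eq_square mult_ac)
    qed
    also have "\<dots> = (norm (hermite_coeff f n))\<^sup>2"
    proof -
      have "((2 ^ n * fact n * sqrt pi) powr (- 1 / 2))\<^sup>2 = 1 / (2 ^ n * fact n * sqrt pi)"
        by (rule powr_neg_half_sq) simp
      then show ?thesis by (simp only: coeff power_mult_distrib power_divide)
    qed
    finally show ?thesis by (rule power2_le_imp_le) simp
  qed
  moreover have "c > 0" using M by (simp add: c_def)
  ultimately show ?thesis using that f by blast
qed

theorem theorem1p3:
  fixes a b :: real
  assumes "0 < a" and "0 < b" and "a * b < 1"
  shows "(\<forall>f \<in> Eab a b. \<exists>K. \<forall>n::nat. n \<ge> 1 \<longrightarrow>
            norm (hermite_coeff f n) \<le>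
              K * real n powr (-1/4) * ((a + b - 2*a*b) / (a + b + 2*a*b)) powr (real n / 4))
       \<and> (\<exists>f \<in> Eab a b. \<exists>c > 0. \<forall>n::nat. n \<ge> 2 \<and> even n \<longrightarrow>
            norm (hermite_coeff f n) \<ge>
              c * real n powr (-1/4) * ((a + b - 2*a*b) / (a + b + 2*a*b)) powr (real n / 4))"
proof -
  define R where "R = (a + b - 2 * a * b) / (a + b + 2 * a * b)"
  have R: "R > 0" unfolding R_def by (rule ratio_pos[OF assms])
  \<comment> \<open>The estimates above use \<open>L = sqrt R\<close>, which turns the exponent
    \<open>n / 4\<close> into \<open>n / 2\<close>.\<close>
  have pow: "sqrt R powr (real n / 2) = R powr (real n / 4)" for n
    using R by (simp add: powr_powr flip: powr_half_sqrt)
  have "\<exists>K. \<forall>n::nat. n \<ge> 1 \<longrightarrow> norm (hermite_coeff f n) \<le> K * real n powr (-1/4) * R powr (real n / 4)"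
    if f: "f \<in> Eab a b" for f
  proof -
    obtain K where "\<And>n. n \<ge> 1 \<Longrightarrow> norm (hermite_coeff f n) \<le> K * (real n powr (- 1 / 4) * sqrt R powr (real n / 2))"
      unfolding R_def by (rule hermite_coeff_upper[OF assms f]) blast
    then show ?thesis unfolding pow by (auto simp: mult.assoc)
  qed
  moreover have "\<exists>f \<in> Eab a b. \<exists>c > 0. \<forall>n::nat. n \<ge> 2 \<and> even n \<longrightarrow>
      norm (hermite_coeff f n) \<ge> c * real n powr (-1/4) * R powr (real n / 4)"
  proof -
    obtain f c where f: "f \<in> Eab a b" "c > 0"
      "\<And>n. n \<ge> 2 \<Longrightarrow> even n \<Longrightarrow> c * (real n powr (- 1 / 4) * sqrt R powr (real n / 2)) \<le> norm (hermite_coeff f n)"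
      unfolding R_def by (rule hermite_coeff_lower[OF assms]) blast
    from f(3) have "\<forall>n::nat. n \<ge> 2 \<and> even n \<longrightarrow>
        norm (hermite_coeff f n) \<ge> c * real n powr (-1/4) * R powr (real n / 4)"
      unfolding pow by (simp add: mult.assoc)
    with f(1,2) show ?thesis by blast
  qed
  ultimately show ?thesis unfolding R_def by blast
qed

end
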